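(* Let $p$ be an odd prime and let $G$ be a finitely generated pro-$p$ group of (finite) powerful class $k$. Suppose that $k\le \ell(p-1)$ for an integer $\ell$. Then $\Omega_i(G)^{p^{i+\ell}}=1$ for all $i\ge 0$.
   Context: Finite generation of a pro-$p$ group is in the topological sense. For a closed subgroup $N$ of a pro-$p$ group and $m\geq 0$, $N^{p^m}$ denotes the closure of the subgroup generated by all $p^m$-th powers of elements of $N$. For $i\ge 0$, $\Omega_i(G)=\langle x\in G\mid x^{p^i}=1\rangle$; the conclusion says that every element of $\Omega_i(G)$ has order dividing $p^{i+\ell}$. Let $p$ be odd. A closed normal subgroup $N$ of a pro-$p$ group $G$ is powerfully embedded in $G$ if $[N,G]\le N^p$. An $\eta$-series of $G$ is an ascending series $1=N_0\le N_1\le N_2\le\cdots$ of closed normal subgroups of $G$ such that $N_{i+1}/N_i$ is powerfully embedded in $G/N_i$ for all $i$. The powerful class of $G$ is the smallest $k$ such that $G$ has an $\eta$-series with $N_k=G$ (if such $k$ exists). *)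

theory Defs
  imports "HOL-Analysis.Analysis" "HOL-Algebra.Generated_Groups"
begin

locale topological_group = group G for G (structure) and T +
  assumes topspace_eq: "topspace T = carrier G"
    and continuous_mult: "continuous_map (prod_topology T T) T (\<lambda>(x, y). x \<otimes> y)"
    and continuous_inv: "continuous_map T T (\<lambda>x. inv x)"

locale profinite_group = topological_group +
  assumes compact: "compact_space T"
    and Hausdorff: "Hausdorff_space T"
    and totally_disconnected: "\<And>C. connectedin T C \<Longrightarrow> \<exists>a. C \<subseteq> {a}"

text \<open>Since an infinite group has \<^const>\<open>order\<close> 0, the condition below includes that
  the quotients by open normal subgroups are finite.\<close>

locale pro_p_group = profinite_group +
  fixes p :: nat
  assumes prime: "prime p"
    and open_normal_index:
      "\<And>U. U \<lhd> G \<Longrightarrow> openin T U \<Longrightarrow> \<exists>n. order (G Mod U) = p ^ n"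

text \<open>All subgroups given by generators are generated topologically.\<close>

definition top_generate :: "('a, 'b) monoid_scheme \<Rightarrow> 'a topology \<Rightarrow> 'a set \<Rightarrow> 'a set" where
  "top_generate G T S = T closure_of (generate G S)"

definition top_finitely_generated :: "('a, 'b) monoid_scheme \<Rightarrow> 'a topology \<Rightarrow> bool" where
  "top_finitely_generated G T \<longleftrightarrow>
     (\<exists>S. finite S \<and> S \<subseteq> carrier G \<and> top_generate G T S = carrier G)"

text \<open>\<open>power_subgroup G T N n\<close> is $N^n$ and \<open>Omega_subgroup p G T i\<close> is $\Omega_i(G)$.\<close>

definition power_subgroup ::
    "('a, 'b) monoid_scheme \<Rightarrow> 'a topology \<Rightarrow> 'a set \<Rightarrow> nat \<Rightarrow> 'a set" where
  "power_subgroup G T N n = top_generate G T {x [^]\<^bsub>G\<^esub> n | x. x \<in> N}"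

definition Omega_subgroup ::
    "nat \<Rightarrow> ('a, 'b) monoid_scheme \<Rightarrow> 'a topology \<Rightarrow> nat \<Rightarrow> 'a set" where
  "Omega_subgroup p G T i =
     top_generate G T {x \<in> carrier G. x [^]\<^bsub>G\<^esub> (p ^ i) = \<one>\<^bsub>G\<^esub>}"

definition commutator_subgroup ::
    "('a, 'b) monoid_scheme \<Rightarrow> 'a topology \<Rightarrow> 'a set \<Rightarrow> 'a set \<Rightarrow> 'a set" where
  "commutator_subgroup G T H K =
     top_generate G T {inv\<^bsub>G\<^esub> x \<otimes>\<^bsub>G\<^esub> inv\<^bsub>G\<^esub> y \<otimes>\<^bsub>G\<^esub> x \<otimes>\<^bsub>G\<^esub> y | x y. x \<in> H \<and> y \<in> K}"

definition quotient_group_topology ::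
    "('a, 'b) monoid_scheme \<Rightarrow> 'a topology \<Rightarrow> 'a set \<Rightarrow> 'a set topology" where
  "quotient_group_topology G T N =
     topology (\<lambda>V. V \<subseteq> carrier (G Mod N) \<and> openin T {x \<in> topspace T. N #>\<^bsub>G\<^esub> x \<in> V})"

lemma openin_quotient_group_topology:
  "openin (quotient_group_topology G T N) V \<longleftrightarrow>
     V \<subseteq> carrier (G Mod N) \<and> openin T {x \<in> topspace T. N #>\<^bsub>G\<^esub> x \<in> V}"
proof -
  have "istopology (\<lambda>V. V \<subseteq> carrier (G Mod N) \<and> openin T {x \<in> topspace T. N #>\<^bsub>G\<^esub> x \<in> V})"
    unfolding istopology_def
  proof (intro conjI allI impI)
    fix A B
    assume A: "A \<subseteq> carrier (G Mod N) \<and> openin T {x \<in> topspace T. N #>\<^bsub>G\<^esub> x \<in> A}"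
      and B: "B \<subseteq> carrier (G Mod N) \<and> openin T {x \<in> topspace T. N #>\<^bsub>G\<^esub> x \<in> B}"
    have "{x \<in> topspace T. N #>\<^bsub>G\<^esub> x \<in> A \<inter> B} =
        {x \<in> topspace T. N #>\<^bsub>G\<^esub> x \<in> A} \<inter> {x \<in> topspace T. N #>\<^bsub>G\<^esub> x \<in> B}"
      by auto
    then show "openin T {x \<in> topspace T. N #>\<^bsub>G\<^esub> x \<in> A \<inter> B}"
      using A B by (simp add: openin_Int)
    show "A \<inter> B \<subseteq> carrier (G Mod N)"
      using A by blast
  next
    fix K
    assume K: "\<forall>A\<in>K. A \<subseteq> carrier (G Mod N) \<and> openin T {x \<in> topspace T. N #>\<^bsub>G\<^esub> x \<in> A}"
    have "{x \<in> topspace T. N #>\<^bsub>G\<^esub> x \<in> \<Union>K} = (\<Union>A\<in>K. {x \<in> topspace T. N #>\<^bsub>G\<^esub> x \<in> A})"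
      by auto
    also have "openin T \<dots>"
      using K by blast
    finally show "openin T {x \<in> topspace T. N #>\<^bsub>G\<^esub> x \<in> \<Union>K}" .
    show "\<Union>K \<subseteq> carrier (G Mod N)"
      using K by blast
  qed
  then show ?thesis
    by (simp add: quotient_group_topology_def topology_inverse')
qed

lemma (in topological_group) quotient_map_quotient_group_topology:
  "quotient_map T (quotient_group_topology G T N) (\<lambda>x. N #> x)"
proof -
  have img: "(\<lambda>x. N #> x) ` carrier G = carrier (G Mod N)"
    by (auto simp: FactGroup_def RCOSETS_def)
  have "openin (quotient_group_topology G T N) (carrier (G Mod N))"
  proof -
    have "{x \<in> topspace T. N #> x \<in> carrier (G Mod N)} = topspace T"
      using img by (auto simp: topspace_eq)
    then show ?thesis
      by (simp add: openin_quotient_group_topology)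
  qed
  then have "topspace (quotient_group_topology G T N) = carrier (G Mod N)"
    by (metis openin_quotient_group_topology openin_subset openin_topspace subset_antisym)
  then show ?thesis
    by (simp add: quotient_map_def topspace_eq img openin_quotient_group_topology)
qed

text \<open>This is the notion of powerful embedding for odd \<open>p\<close>.\<close>

definition powerfully_embedded ::
    "nat \<Rightarrow> ('a, 'b) monoid_scheme \<Rightarrow> 'a topology \<Rightarrow> 'a set \<Rightarrow> bool" where
  "powerfully_embedded p G T N \<longleftrightarrow>
     closedin T N \<and> N \<lhd> G \<and> commutator_subgroup G T N (carrier G) \<subseteq> power_subgroup G T N p"

definition eta_series ::
    "nat \<Rightarrow> ('a, 'b) monoid_scheme \<Rightarrow> 'a topology \<Rightarrow> (nat \<Rightarrow> 'a set) \<Rightarrow> bool" where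
  "eta_series p G T N \<longleftrightarrow>
     N 0 = {\<one>\<^bsub>G\<^esub>} \<and>
     (\<forall>i. closedin T (N i) \<and> N i \<lhd> G \<and> N i \<subseteq> N (Suc i)) \<and>
     (\<forall>i. powerfully_embedded p (G Mod N i) (quotient_group_topology G T (N i))
            ((\<lambda>x. N i #>\<^bsub>G\<^esub> x) ` N (Suc i)))"

definition has_powerful_class ::
    "nat \<Rightarrow> ('a, 'b) monoid_scheme \<Rightarrow> 'a topology \<Rightarrow> nat \<Rightarrow> bool" where
  "has_powerful_class p G T k \<longleftrightarrow>
     (\<exists>N. eta_series p G T N \<and> N k = carrier G) \<and>
     (\<forall>j<k. \<not> (\<exists>N. eta_series p G T N \<and> N j = carrier G))"

end

theory Submission
  imports Defs "HOL-Algebra.Group_Action" "HOL-Algebra.Multiplicative_Group"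
begin

text \<open>Every element other than 1 of a pro-\<open>p\<close> group survives in a finite quotient by an open
  normal subgroup, so it suffices to treat finite \<open>p\<close>-groups. There an \<open>\<eta>\<close>-series of length
  \<open>k\<close> is turned into the central series \<open>F\<^sub>k = G\<close>, \<open>F\<^sub>j = \<langle>N\<^sub>j, F\<^sub>j\<^sub>+\<^sub>1\<^sup>p\<rangle>\<close>, whose term \<open>F\<^sub>1\<close> is
  powerfully embedded. Let \<open>H = \<Omega>\<^sub>i(G)\<close>, so that \<open>\<gamma>\<^sub>k(H) \<le> F\<^sub>1\<close>. Adapting
  Fernandez-Alcober's argument for powerful groups, one gets that
  \<open>\<gamma>\<^sub>k\<^sub>+\<^sub>1\<^sub>+\<^sub>s(H)\<close> has exponent dividing \<open>p\<^sup>i\<^sup>-\<^sup>s\<close>. The Hall--Petrescu formula then yields, by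
  downward induction on \<open>r\<close>, that \<open>\<gamma>\<^sub>r(H)\<close> has exponent dividing \<open>p\<^sup>m\<close> whenever
  \<open>k + 1 + (p - 1) i \<le> r + (p - 1) m\<close>; the theorem is the case \<open>r = 1\<close>, \<open>m = i + \<ell>\<close>.\<close>

subsection \<open>Commutators and powers modulo a normal subgroup\<close>

text \<open>The obstacle is that \<open>H\<close> is only generated by elements of small order and
  \<open>G\<close> need not be powerful, so orders must be carried to products and commutators by
  two different devices. Near \<open>F_1\<close> depth is traded for order: an element of the m-th
  iterated power term of \<open>F_1\<close> is a p^m-th power, and bounds for commutators of its
  root, whose order is larger, give back more than they cost. Each further commutator with a
  generator of \<open>H\<close> then saves one factor p. Above \<open>F_1\<close> the p^m-th power
  map is made multiplicative on \<open><x, gamma_r(H)>\<close> for x in \<open>H\<close>: the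
  Hall-Petrescu corrections are powers w^(p^m choose s) with w in \<open>gamma_{r+s-1}(H)\<close>.
  If p^v is the exact power of p dividing s, the binomial is divisible by p^(m-v), and p^v <= s
  gives (p-1) v <= s-1. So s-1 steps down the series pay for the loss of v in the exponent; this is
  the origin of the slope p-1. Multiplicativity is applied to x and [x,c], whose product is the
  conjugate of a generator x by c, so the bound for x passes to [x,c].\<close>

definition commutator :: "('a, 'b) monoid_scheme \<Rightarrow> 'a \<Rightarrow> 'a \<Rightarrow> 'a" where
  "commutator G x y = inv\<^bsub>G\<^esub> x \<otimes>\<^bsub>G\<^esub> inv\<^bsub>G\<^esub> y \<otimes>\<^bsub>G\<^esub> x \<otimes>\<^bsub>G\<^esub> y"

definition commutator_gen :: "('a, 'b) monoid_scheme \<Rightarrow> 'a set \<Rightarrow> 'a set \<Rightarrow> 'a set" where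
  "commutator_gen G A B = generate G {commutator G x y | x y. x \<in> A \<and> y \<in> B}"

definition power_gen :: "('a, 'b) monoid_scheme \<Rightarrow> nat \<Rightarrow> 'a set \<Rightarrow> 'a set" where
  "power_gen G n A = generate G {x [^]\<^bsub>G\<^esub> n | x. x \<in> A}"

context group
begin

abbreviation cmt :: "'a \<Rightarrow> 'a \<Rightarrow> 'a" where
  "cmt \<equiv> commutator G"

lemma inv_mult_cancel_left:
  "\<lbrakk>x \<in> carrier G; y \<in> carrier G\<rbrakk> \<Longrightarrow> inv x \<otimes> (x \<otimes> y) = y"
  "\<lbrakk>x \<in> carrier G; y \<in> carrier G\<rbrakk> \<Longrightarrow> x \<otimes> (inv x \<otimes> y) = y"
  by (simp_all flip: m_assoc)

lemmas word_simps = commutator_def m_assoc inv_mult_group inv_mult_cancel_left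

lemma commutator_closed [simp, intro]:
  "\<lbrakk>x \<in> carrier G; y \<in> carrier G\<rbrakk> \<Longrightarrow> cmt x y \<in> carrier G"
  by (simp add: commutator_def)

lemma commutator_mult_left:
  "\<lbrakk>x \<in> carrier G; x' \<in> carrier G; y \<in> carrier G\<rbrakk> \<Longrightarrow>
     cmt (x \<otimes> x') y = (inv x' \<otimes> cmt x y \<otimes> x') \<otimes> cmt x' y"
  by (simp add: word_simps)

lemma commutator_inv_left:
  "\<lbrakk>x \<in> carrier G; y \<in> carrier G\<rbrakk> \<Longrightarrow> cmt (inv x) y = x \<otimes> inv (cmt x y) \<otimes> inv x"
  by (simp add: word_simps)

lemma commutator_swap:
  "\<lbrakk>x \<in> carrier G; y \<in> carrier G\<rbrakk> \<Longrightarrow> cmt y x = inv (cmt x y)"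
  by (simp add: word_simps)

lemma conj_eq_mult_commutator:
  "\<lbrakk>x \<in> carrier G; y \<in> carrier G\<rbrakk> \<Longrightarrow> inv y \<otimes> x \<otimes> y = x \<otimes> cmt x y"
  by (simp add: word_simps)

lemma conj_pow:
  "\<lbrakk>x \<in> carrier G; y \<in> carrier G\<rbrakk> \<Longrightarrow> (inv y \<otimes> x \<otimes> y) [^] (n::nat) = inv y \<otimes> x [^] n \<otimes> y"
  by (induction n) (simp_all add: m_assoc inv_mult_cancel_left)

text \<open>As x [x,y] is the conjugate of x by y, its powers are conjugates of powers. Thus
  commutators of powers become powers of products.\<close>

lemma commutator_pow_left:
  "\<lbrakk>x \<in> carrier G; y \<in> carrier G\<rbrakk> \<Longrightarrow>
     cmt (x [^] (n::nat)) y = inv (x [^] n) \<otimes> (x \<otimes> cmt x y) [^] n"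
  by (simp add: conj_eq_mult_commutator[symmetric] conj_pow)
    (simp add: word_simps)

lemma normal_conj_closed:
  "\<lbrakk>W \<lhd> G; w \<in> W; g \<in> carrier G\<rbrakk> \<Longrightarrow> inv g \<otimes> w \<otimes> g \<in> W"
  by (rule normal.inv_op_closed1)

lemma normal_commutator_closed:
  assumes "W \<lhd> G" "w \<in> W" "g \<in> carrier G"
  shows "cmt w g \<in> W" "cmt g w \<in> W"
proof -
  interpret normal W G by fact
  have *: "w \<in> carrier G" using assms by auto
  have "cmt w g = inv w \<otimes> (inv g \<otimes> w \<otimes> g)"
    using assms * by (simp add: word_simps)
  then show 1: "cmt w g \<in> W"
    using assms normal_conj_closed by simp
  then show "cmt g w \<in> W"
    using assms * commutator_swap[of w g] by simp
qed

lemma commutator_swap_mem: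
  assumes "subgroup W G" "x \<in> carrier G" "y \<in> carrier G" "cmt x y \<in> W"
  shows "cmt y x \<in> W"
  using assms commutator_swap[of x y] by (simp add: subgroup.m_inv_closed)

lemma subgroup_centralizer_mod:
  assumes W: "W \<lhd> G" and B: "B \<subseteq> carrier G"
  shows "subgroup {x \<in> carrier G. \<forall>y\<in>B. cmt x y \<in> W} G"
proof -
  interpret normal W G by fact
  have one: "cmt \<one> y \<in> W" if "y \<in> B" for y
    using B that by (auto simp: word_simps)
  have m: "cmt (x \<otimes> x') y \<in> W"
    if "x \<in> carrier G" "x' \<in> carrier G" "y \<in> carrier G" "cmt x y \<in> W" "cmt x' y \<in> W" for x x' y
    using that normal_conj_closed[OF W] by (simp add: commutator_mult_left)
  have i: "cmt (inv x) y \<in> W"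
    if "x \<in> carrier G" "y \<in> carrier G" "cmt x y \<in> W" for x y
    using that inv_op_closed2 by (simp add: commutator_inv_left)
  show ?thesis
    by (rule subgroupI) (use B one m i in \<open>auto simp: subset_iff\<close>)
qed

text \<open>Centralizers modulo \<open>W\<close> are subgroups: fix a generator on the right and let
  \<open>x\<close> vary over the generated subgroup, then fix \<open>x\<close> and let
  \<open>y\<close> vary.\<close>

lemma commutator_generate_mem:
  assumes W: "W \<lhd> G" and S: "S \<subseteq> carrier G" and S': "S' \<subseteq> carrier G"
    and c: "\<And>s s'. s \<in> S \<Longrightarrow> s' \<in> S' \<Longrightarrow> cmt s s' \<in> W"
    and x: "x \<in> generate G S" and y: "y \<in> generate G S'"
  shows "cmt x y \<in> W"
proof -
  have sub: "subgroup W G" using W by (rule normal_imp_subgroup)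
  have "generate G S \<subseteq> {x \<in> carrier G. \<forall>y\<in>S'. cmt x y \<in> W}"
    by (rule generate_subgroup_incl[OF _ subgroup_centralizer_mod[OF W S']]) (use S c in auto)
  then have 1: "cmt x y \<in> W" if "y \<in> S'" for y
    using x that by auto
  have xG: "x \<in> carrier G" using x S generate_in_carrier by blast
  have "generate G S' \<subseteq> {y \<in> carrier G. \<forall>x\<in>{x}. cmt y x \<in> W}"
    by (rule generate_subgroup_incl[OF _ subgroup_centralizer_mod[OF W]])
      (use S' xG 1 sub in \<open>auto intro: commutator_swap_mem\<close>)
  then show ?thesis
    using y xG sub commutator_swap_mem by auto
qed

lemma commutator_gen_normal:
  assumes "A \<lhd> G" "B \<lhd> G"
  shows "commutator_gen G A B \<lhd> G"
proof -
  interpret A: normal A G by fact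
  interpret B: normal B G by fact
  have "g \<otimes> cmt x y \<otimes> inv g = cmt (g \<otimes> x \<otimes> inv g) (g \<otimes> y \<otimes> inv g)"
    if "g \<in> carrier G" "x \<in> carrier G" "y \<in> carrier G" for g x y
    using that by (simp add: word_simps)
  then show ?thesis
    unfolding commutator_gen_def
    by (intro normal_generateI) (auto, use A.inv_op_closed2 B.inv_op_closed2 in blast)
qed

lemma power_gen_normal:
  assumes "A \<lhd> G"
  shows "power_gen G n A \<lhd> G"
proof -
  interpret A: normal A G by fact
  have "g \<otimes> x [^] n \<otimes> inv g = (g \<otimes> x \<otimes> inv g) [^] n"
    if "g \<in> carrier G" "x \<in> carrier G" for g x
    using conj_pow[of x "inv g" n] that by simp
  then show ?thesis
    unfolding power_gen_def
    by (intro normal_generateI) (auto, use A.inv_op_closed2 in blast)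
qed

lemma commutator_mem_commutator_gen: "x \<in> A \<Longrightarrow> y \<in> B \<Longrightarrow> cmt x y \<in> commutator_gen G A B"
  unfolding commutator_gen_def by (rule generate.incl) auto

lemma pow_mem_power_gen: "x \<in> A \<Longrightarrow> x [^] n \<in> power_gen G n A"
  unfolding power_gen_def by (rule generate.incl) auto

lemma subgroup_pow_closed: "subgroup A G \<Longrightarrow> x \<in> A \<Longrightarrow> x [^] (n::nat) \<in> A"
  by (induction n) (auto simp: subgroup.one_closed subgroup.m_closed)

lemma power_gen_subset: "subgroup A G \<Longrightarrow> power_gen G n A \<subseteq> A"
  unfolding power_gen_def
  by (rule generate_subgroup_incl) (auto intro: subgroup_pow_closed)

text \<open>The commutator z = [a,u] is central in the subgroup generated by u and a. Moving u to
  the left past a^m leaves z^m, and summing m over m < n gives \<open>n choose 2\<close>.\<close>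

lemma class2_pow:
  assumes G: "u \<in> carrier G" "a \<in> carrier G"
    and u: "cmt a u \<otimes> u = u \<otimes> cmt a u" and a: "cmt a u \<otimes> a = a \<otimes> cmt a u"
  shows "(u \<otimes> a) [^] (n::nat) = u [^] n \<otimes> a [^] n \<otimes> cmt a u [^] (n choose 2)"
proof -
  define z where "z = cmt a u"
  have z: "z \<in> carrier G" using G by (simp add: z_def)
  have au: "a \<otimes> u = u \<otimes> (a \<otimes> z)" using G by (simp add: z_def word_simps)
  have comm: "x [^] (m::nat) \<otimes> y = y \<otimes> x [^] m" if "x \<otimes> y = y \<otimes> x" "x \<in> carrier G" "y \<in> carrier G" for x y m
    using that by (rule group_commutes_pow)
  have zu: "z [^] m \<otimes> u = u \<otimes> z [^] m" and za: "z [^] m \<otimes> a = a \<otimes> z [^] m" for m :: nat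
    by (rule comm; use u a z G in \<open>simp add: z_def\<close>)+
  have zaw: "z [^] m \<otimes> (a \<otimes> w) = a \<otimes> (z [^] m \<otimes> w)" if "w \<in> carrier G" for m :: nat and w
    using G z that za[of m] by (simp flip: m_assoc)
  have apu: "a [^] m \<otimes> u = u \<otimes> (a [^] m \<otimes> z [^] m)" for m :: nat
  proof (induction m)
    case (Suc m)
    have "a [^] Suc m \<otimes> u = a [^] m \<otimes> (u \<otimes> (a \<otimes> z))"
      using G z by (simp add: m_assoc au)
    also have "\<dots> = (a [^] m \<otimes> u) \<otimes> (a \<otimes> z)"
      using G z by (simp add: m_assoc)
    also have "\<dots> = u \<otimes> (a [^] m \<otimes> (z [^] m \<otimes> a) \<otimes> z)"
      using G z by (simp add: Suc.IH m_assoc)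
    also have "\<dots> = u \<otimes> (a [^] Suc m \<otimes> z [^] Suc m)"
      using G z by (simp add: za m_assoc)
    finally show ?case .
  qed (use G in simp)
  have "(u \<otimes> a) [^] n = u [^] n \<otimes> a [^] n \<otimes> z [^] (n choose 2)"
  proof (induction n)
    case (Suc n)
    let ?c = "n choose 2"
    have "(u \<otimes> a) [^] Suc n = u [^] n \<otimes> (a [^] n \<otimes> ((z [^] ?c \<otimes> u) \<otimes> a))"
      using G z by (simp add: Suc.IH m_assoc)
    also have "\<dots> = u [^] n \<otimes> ((a [^] n \<otimes> u) \<otimes> (z [^] ?c \<otimes> a))"
      using G z by (simp add: zu m_assoc)
    also have "\<dots> = u [^] Suc n \<otimes> (a [^] n \<otimes> ((z [^] n \<otimes> a) \<otimes> z [^] ?c))"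
      using G z by (simp add: apu zaw za m_assoc)
    also have "\<dots> = u [^] Suc n \<otimes> (a [^] Suc n \<otimes> z [^] (n + ?c))"
      using G z by (simp add: zaw m_assoc nat_pow_mult)
    also have "n + ?c = Suc n choose 2"
      by (simp add: numeral_2_eq_2)
    finally show ?case using G z by (simp add: m_assoc)
  qed (use G in \<open>simp add: numeral_2_eq_2\<close>)
  then show ?thesis by (simp add: z_def)
qed

end

lemma (in group_hom) hom_commutator:
  "\<lbrakk>x \<in> carrier G; y \<in> carrier G\<rbrakk> \<Longrightarrow> h (commutator G x y) = commutator H (h x) (h y)"
  by (simp add: commutator_def)

lemma (in group) commutator_one_iff:
  assumes "x \<in> carrier G" "y \<in> carrier G"
  shows "commutator G x y = \<one> \<longleftrightarrow> x \<otimes> y = y \<otimes> x"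
proof -
  have "commutator G x y = inv (y \<otimes> x) \<otimes> (x \<otimes> y)"
    using assms by (simp add: word_simps)
  then show ?thesis
    using assms by (metis inv_closed inv_equality inv_inv m_closed r_inv l_inv)
qed

lemma (in normal) group_hom_Mod: "group_hom G (G Mod H) (\<lambda>x. H #> x)"
  using r_coset_hom_Mod factorgroup_is_group by (simp add: group_hom_def group_hom_axioms_def is_group)

lemma (in normal) r_coset_one_iff: "x \<in> carrier G \<Longrightarrow> H #> x = \<one>\<^bsub>G Mod H\<^esub> \<longleftrightarrow> x \<in> H"
  using rcos_const coset_join1[of H x] subgroup_axioms subset by auto

lemma (in group_hom) hom_class2_pow:
  fixes n :: nat
  assumes G: "u \<in> carrier G" "a \<in> carrier G"
    and u: "h (commutator G (commutator G a u) u) = \<one>\<^bsub>H\<^esub>"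
    and a: "h (commutator G (commutator G a u) a) = \<one>\<^bsub>H\<^esub>"
    and pow: "h (commutator G a u [^] (n choose 2)) = \<one>\<^bsub>H\<^esub>"
  shows "h ((u \<otimes> a) [^] n) = h (u [^] n \<otimes> a [^] n)"
proof -
  define z where "z = commutator G a u"
  have z: "z \<in> carrier G" using G by (simp add: z_def)
  have hz: "h z = commutator H (h a) (h u)"
    using G by (simp add: z_def hom_commutator)
  have "commutator H (h z) (h x) = \<one>\<^bsub>H\<^esub>" if "x \<in> {u, a}" for x
    using that u a G z hom_commutator[of z x] by (auto simp: z_def)
  then have comm: "h z \<otimes>\<^bsub>H\<^esub> h x = h x \<otimes>\<^bsub>H\<^esub> h z" if "x \<in> {u, a}" for x
    using that G z H.commutator_one_iff[of "h z" "h x"] by auto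
  have "(h u \<otimes>\<^bsub>H\<^esub> h a) [^]\<^bsub>H\<^esub> n = h u [^]\<^bsub>H\<^esub> n \<otimes>\<^bsub>H\<^esub> h a [^]\<^bsub>H\<^esub> n \<otimes>\<^bsub>H\<^esub> h z [^]\<^bsub>H\<^esub> (n choose 2)"
    unfolding hz by (rule H.class2_pow) (use G comm in \<open>simp_all flip: hz\<close>)
  moreover have "h z [^]\<^bsub>H\<^esub> (n choose 2) = \<one>\<^bsub>H\<^esub>"
    using pow z by (simp add: z_def[symmetric] hom_nat_pow)
  ultimately show ?thesis
    using G by (simp add: hom_nat_pow)
qed

lemma (in group_hom) hom_eq_imp_quotient:
  "\<lbrakk>x \<in> carrier G; y \<in> carrier G; h x = h y\<rbrakk> \<Longrightarrow> h (inv y \<otimes> x) = \<one>\<^bsub>H\<^esub>"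
  by simp

lemma (in group) class2_pow_mod:
  fixes n :: nat
  assumes W: "W \<lhd> G" and G: "u \<in> carrier G" "a \<in> carrier G"
    and "cmt (cmt a u) u \<in> W" "cmt (cmt a u) a \<in> W" "cmt a u [^] (n choose 2) \<in> W"
  shows "\<exists>w\<in>W. (u \<otimes> a) [^] n = u [^] n \<otimes> a [^] n \<otimes> w"
proof -
  interpret normal W G by fact
  define h where "h = (\<lambda>x. W #> x)"
  interpret h: group_hom G "G Mod W" h
    unfolding h_def by (rule group_hom_Mod)
  have one: "h x = \<one>\<^bsub>G Mod W\<^esub> \<longleftrightarrow> x \<in> W" if "x \<in> carrier G" for x
    unfolding h_def using that by (rule r_coset_one_iff)
  define y where "y = u [^] n \<otimes> a [^] n"
  have y: "y \<in> carrier G" using G by (simp add: y_def)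
  have "h ((u \<otimes> a) [^] n) = h y"
    unfolding y_def using assms by (intro h.hom_class2_pow) (simp_all only: one commutator_closed nat_pow_closed)
  then have "h (inv y \<otimes> (u \<otimes> a) [^] n) = \<one>\<^bsub>G Mod W\<^esub>"
    by (intro h.hom_eq_imp_quotient) (use G y in auto)
  then have "inv y \<otimes> (u \<otimes> a) [^] n \<in> W"
    using G y by (subst one[symmetric]) auto
  moreover have "(u \<otimes> a) [^] n = y \<otimes> (inv y \<otimes> (u \<otimes> a) [^] n)"
    using G y by (simp add: word_simps)
  ultimately show ?thesis unfolding y_def by blast
qed

subsection \<open>Finite p-groups\<close>

locale finite_p_group = group +
  fixes p :: nat
  assumes prime: "prime p" and order_prime_power: "\<exists>e. order G = p ^ e"
begin

lemma finite_carrier: "finite (carrier G)"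
  using order_prime_power order_gt_0_iff_finite prime by (auto simp: prime_gt_0_nat)

lemma subgroup_finite_p_group:
  assumes "subgroup K G"
  shows "finite_p_group (G\<lparr>carrier := K\<rparr>) p"
proof -
  obtain e where e: "order G = p ^ e" using order_prime_power by blast
  have "card K dvd p ^ e"
    using lagrange[OF assms] e by (metis dvd_triv_right)
  then have "\<exists>e. order (G\<lparr>carrier := K\<rparr>) = p ^ e"
    using divides_primepow_nat[OF prime] by (auto simp: order_def)
  then show ?thesis
    using subgroup_imp_group[OF assms] prime
    by (simp add: finite_p_group_def finite_p_group_axioms_def)
qed

lemma normal_finite_p_group_Mod:
  assumes "M \<lhd> G"
  shows "finite_p_group (G Mod M) p"
proof -
  interpret normal M G by fact
  obtain e where e: "order G = p ^ e" using order_prime_power by blast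
  have "card (rcosets M) dvd p ^ e"
    using lagrange[OF subgroup_axioms] e by (metis dvd_triv_left)
  then have "\<exists>e. order (G Mod M) = p ^ e"
    using divides_primepow_nat[OF prime] by (auto simp: order_def FactGroup_def)
  then show ?thesis
    using factorgroup_is_group prime
    by (simp add: finite_p_group_def finite_p_group_axioms_def)
qed

lemma ex_exponent: "\<exists>e. \<forall>x\<in>carrier G. x [^] (p ^ e) = \<one>"
  using order_prime_power pow_order_eq_1 by metis

text \<open>Class equation: otherwise each conjugacy class in \<open>Y\<close> other than that of 1
  has size a positive power of p, so p divides |Y| - 1 as well as |Y|.\<close>

lemma normal_meets_center:
  assumes Y: "Y \<lhd> G" and nontriv: "Y \<noteq> {\<one>}"
  shows "\<exists>y\<in>Y. y \<noteq> \<one> \<and> (\<forall>g\<in>carrier G. cmt y g = \<one>)"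
proof (rule ccontr)
  assume contra: "\<not> ?thesis"
  interpret Y: normal Y G by fact
  obtain e where e: "order G = p ^ e" using order_prime_power by blast
  define \<phi> where "\<phi> = (\<lambda>g. \<lambda>h\<in>carrier G. g \<otimes> h \<otimes> inv g)"
  interpret A: group_action G "carrier G" \<phi>
    unfolding \<phi>_def by (rule action_by_conjugation)
  define C where "C = {orb \<in> orbits G (carrier G) \<phi>. orb \<subseteq> Y \<and> orb \<noteq> {\<one>}}"
  have finY: "finite Y" using finite_carrier finite_subset Y.subset by blast
  have orb: "orbit G \<phi> x = {g \<otimes> x \<otimes> inv g | g. g \<in> carrier G}" if "x \<in> carrier G" for x
    using that by (auto simp: orbit_def \<phi>_def)
  have orb1: "orbit G \<phi> \<one> = {\<one>}"
    by (subst orb) (auto intro!: exI[of _ "\<one>"])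
  have self: "x \<in> orbit G \<phi> x" if "x \<in> carrier G" for x
    using A.orbit_refl that .
  have U: "\<Union>C = Y - {\<one>}"
  proof
    show "\<Union>C \<subseteq> Y - {\<one>}"
    proof
      fix x assume "x \<in> \<Union>C"
      then obtain c where c: "c \<in> orbits G (carrier G) \<phi>" "c \<subseteq> Y" "c \<noteq> {\<one>}" "x \<in> c"
        by (auto simp: C_def)
      have "{\<one>} \<in> orbits G (carrier G) \<phi>"
        unfolding orbits_def using orb1 by force
      then have "c \<inter> {\<one>} = {}"
        using A.disjoint_union[OF c(1)] c(3) by auto
      then show "x \<in> Y - {\<one>}" using c by auto
    qed
    show "Y - {\<one>} \<subseteq> \<Union>C"
    proof
      fix x assume x: "x \<in> Y - {\<one>}"
      have "orbit G \<phi> x \<subseteq> Y"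
        using x Y.subset by (subst orb) (auto intro: Y.inv_op_closed2)
      moreover have "orbit G \<phi> x \<in> orbits G (carrier G) \<phi>"
        unfolding orbits_def using x Y.subset by blast
      ultimately show "x \<in> \<Union>C"
        using self[of x] x Y.subset unfolding C_def by (intro UnionI[of "orbit G \<phi> x"]) auto
    qed
  qed
  have "p dvd card c" if c: "c \<in> C" for c
  proof -
    obtain x where x: "x \<in> carrier G" "c = orbit G \<phi> x"
      using c by (auto simp: C_def orbits_def)
    have "x \<in> Y" "x \<noteq> \<one>"
      using self[OF x(1)] x U c by auto
    then obtain g where g: "g \<in> carrier G" "cmt x g \<noteq> \<one>"
      using contra by blast
    have "card c dvd p ^ e"
      using A.orbit_stabilizer_theorem[of x] x e by (metis dvd_triv_left)
    then obtain i where i: "card c = p ^ i"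
      using divides_primepow_nat[OF prime] by blast
    have "i \<noteq> 0"
    proof
      assume "i = 0"
      then have "c = {x}"
        using i self[OF x(1)] x by (auto simp: card_1_singleton_iff)
      moreover have "inv g \<otimes> x \<otimes> inv (inv g) \<in> orbit G \<phi> x"
        unfolding orb[OF x(1)] using inv_closed[OF g(1)] by blast
      ultimately have "inv g \<otimes> x \<otimes> inv (inv g) = x"
        using x(2) by simp
      then have "cmt x g = \<one>"
        using g(1) x(1) by (simp add: commutator_def m_assoc)
      then show False using g by blast
    qed
    then show ?thesis using i by simp
  qed
  moreover have "\<forall>c1\<in>C. \<forall>c2\<in>C. c1 \<noteq> c2 \<longrightarrow> c1 \<inter> c2 = {}"
    using A.disjoint_union by (auto simp: C_def)
  ultimately have "p dvd card (Y - {\<one>})"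
    using dvd_partition[of C p] finY U by auto
  moreover have "card Y = Suc (card (Y - {\<one>}))"
    using finY Y.one_closed by (rule card.remove)
  moreover have "p dvd card Y"
  proof -
    have "card Y dvd p ^ e"
      using lagrange[OF Y.subgroup_axioms] e by (metis dvd_triv_right)
    then obtain i where i: "card Y = p ^ i"
      using divides_primepow_nat[OF prime] by blast
    have "card Y \<noteq> 1"
    proof
      assume "card Y = 1"
      then obtain z where "Y = {z}" by (rule card_1_singletonE)
      then show False using Y.one_closed nontriv by blast
    qed
    then have "i \<noteq> 0" using i by (intro notI) simp
    then show ?thesis using i by simp
  qed
  ultimately have "p dvd 1"
    by (metis Suc_eq_plus1 dvd_add_right_iff)
  then show False using prime by simp
qed

lemma normal_meets_center_order_p:
  assumes Y: "Y \<lhd> G" and nontriv: "Y \<noteq> {\<one>}"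
  shows "\<exists>y\<in>Y. y \<noteq> \<one> \<and> (\<forall>g\<in>carrier G. cmt y g = \<one>) \<and> y [^] p = \<one>"
proof -
  obtain y where y: "y \<in> Y" "y \<noteq> \<one>" and central: "\<And>g. g \<in> carrier G \<Longrightarrow> cmt y g = \<one>"
    using normal_meets_center[OF assms] by metis
  have sub: "subgroup Y G" using Y by (rule normal_imp_subgroup)
  have yG: "y \<in> carrier G" using sub y(1) by (rule subgroup.mem_carrier)
  define n where "n = (LEAST n. y [^] (p ^ n) = \<one>)"
  have "\<exists>n. y [^] (p ^ n) = \<one>" using ex_exponent yG by metis
  then have n: "y [^] (p ^ n) = \<one>"
    unfolding n_def by (rule LeastI_ex)
  have "n \<noteq> 0"
    using n y yG by (metis nat_pow_eone power_0)
  then obtain m where m: "n = Suc m" by (rule not0_implies_Suc[THEN exE])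
  define z where "z = y [^] (p ^ m)"
  have "z \<noteq> \<one>"
    using not_less_Least[of m "\<lambda>n. y [^] (p ^ n) = \<one>", folded n_def] m by (simp add: z_def)
  moreover have "z \<in> Y" using sub y by (simp add: z_def subgroup_pow_closed)
  moreover have "z [^] p = \<one>"
    using n yG nat_pow_pow[OF yG, of "p ^ m" p] by (simp add: z_def m mult.commute)
  moreover have "cmt z g = \<one>" if "g \<in> carrier G" for g
    unfolding z_def using that yG commutator_pow_left[OF yG that, of "p ^ m"] central[OF that] by simp
  ultimately show ?thesis by blast
qed

text \<open>To prove \<open>X\<close> contained in \<open>W\<close> one may work modulo some
  \<open>M\<close> above \<open>W\<close> for which the image of \<open>X\<close> is central of
  exponent p. The contradiction comes from an \<open>M\<close> maximal among the normal subgroups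
  that contain \<open>W\<close> but not \<open>X\<close>.\<close>

lemma normal_subset_reduction:
  assumes X: "X \<lhd> G" and W: "W \<lhd> G"
    and step: "\<And>M. \<lbrakk>M \<lhd> G; W \<subseteq> M; \<And>x g. x \<in> X \<Longrightarrow> g \<in> carrier G \<Longrightarrow> cmt x g \<in> M;
      \<And>x. x \<in> X \<Longrightarrow> x [^] p \<in> M\<rbrakk> \<Longrightarrow> X \<subseteq> M"
  shows "X \<subseteq> W"
proof (rule ccontr)
  assume "\<not> X \<subseteq> W"
  define F where "F = {M. M \<lhd> G \<and> W \<subseteq> M \<and> \<not> X \<subseteq> M}"
  have "F \<subseteq> Pow (carrier G)"
    by (auto simp: F_def dest!: normal_imp_subgroup subgroup.subset)
  then have "finite F" using finite_carrier finite_subset by blast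
  moreover have "F \<noteq> {}" using \<open>\<not> X \<subseteq> W\<close> W by (auto simp: F_def)
  ultimately obtain M where M: "M \<in> F" and max: "\<forall>M'\<in>F. M \<subseteq> M' \<longrightarrow> M = M'"
    using finite_has_maximal[of F] by metis
  have MG: "M \<lhd> G" using M by (simp add: F_def)
  interpret M: normal M G by fact
  interpret X: normal X G by fact
  interpret Q: finite_p_group "G Mod M" p by (rule normal_finite_p_group_Mod[OF MG])
  define h where "h = (\<lambda>x. M #> x)"
  interpret h: group_hom G "G Mod M" h
    unfolding h_def by (rule M.group_hom_Mod)
  have one: "h x = \<one>\<^bsub>G Mod M\<^esub> \<longleftrightarrow> x \<in> M" if "x \<in> carrier G" for x
    unfolding h_def using that by (rule M.r_coset_one_iff)
  have onto: "carrier (G Mod M) = h ` carrier G"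
    by (simp add: h_def carrier_FactGroup)
  have "h ` X \<lhd> G Mod M"
    using X.surj_hom_normal_subgroup[OF h.group_hom_axioms] onto by simp
  moreover have "h ` X \<noteq> {\<one>\<^bsub>G Mod M\<^esub>}"
  proof -
    obtain x where x: "x \<in> X" "x \<notin> M" using M by (auto simp: F_def)
    then have "h x \<noteq> \<one>\<^bsub>G Mod M\<^esub>" using one[of x] X.mem_carrier[of x] by metis
    then show ?thesis using x(1) by (metis image_eqI singletonD)
  qed
  ultimately obtain y where y: "y \<in> h ` X" "y \<noteq> \<one>\<^bsub>G Mod M\<^esub>"
    "\<forall>g\<in>carrier (G Mod M). commutator (G Mod M) y g = \<one>\<^bsub>G Mod M\<^esub>" "y [^]\<^bsub>G Mod M\<^esub> p = \<one>\<^bsub>G Mod M\<^esub>"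
    by (metis Q.normal_meets_center_order_p)
  then obtain x where x: "x \<in> X" "y = h x" by (metis imageE)
  have xG: "x \<in> carrier G" using x by simp
  \<comment> \<open>Modulo \<open>M\<close> this consists of the elements of \<open>X\<close> that
    are central and killed by p. It is strictly larger than \<open>M\<close> because a nontrivial
    normal subgroup of the p-group \<open>G Mod M\<close> has a central element of order p.\<close>
  define M1 where "M1 = {g \<in> carrier G. (\<exists>x\<in>X. inv g \<otimes> x \<in> M) \<and> (\<forall>k\<in>carrier G. cmt g k \<in> M) \<and> g [^] p \<in> M}"
  have cent: "subgroup {g \<in> carrier G. \<forall>k\<in>carrier G. cmt g k \<in> M} G"
    by (rule subgroup_centralizer_mod[OF MG]) simp
  have sub: "M \<subseteq> M1"
  proof
    fix g assume g: "g \<in> M"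
    then have "inv g \<otimes> \<one> \<in> M" by simp
    then have "\<exists>x\<in>X. inv g \<otimes> x \<in> M" using X.one_closed by (rule bexI)
    then show "g \<in> M1"
      using g normal_commutator_closed(1)[OF MG g] subgroup_pow_closed[OF M.subgroup_axioms g]
      by (simp add: M1_def)
  qed
  have mult: "g \<otimes> g' \<in> M1" if g: "g \<in> M1" and g': "g' \<in> M1" for g g'
  proof -
    have G: "g \<in> carrier G" "g' \<in> carrier G" using g g' by (auto simp: M1_def)
    obtain x x' where xx: "x \<in> X" "x' \<in> X" "inv g \<otimes> x \<in> M" "inv g' \<otimes> x' \<in> M"
      using g g' by (auto simp: M1_def)
    then have xG: "x \<in> carrier G" "x' \<in> carrier G" using X.subset by auto
    have "inv (g \<otimes> g') \<otimes> (x \<otimes> x') = (inv g' \<otimes> (inv g \<otimes> x) \<otimes> g') \<otimes> (inv g' \<otimes> x')"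
      using G xG by (simp add: word_simps)
    then have 1: "inv (g \<otimes> g') \<otimes> (x \<otimes> x') \<in> M"
      using xx normal_conj_closed[OF MG] G by simp
    have 2: "\<forall>k\<in>carrier G. cmt (g \<otimes> g') k \<in> M"
      using subgroup.m_closed[OF cent, of g g'] g g' by (auto simp: M1_def)
    have c: "cmt g' g \<in> M" using g' G by (auto simp: M1_def)
    obtain w where "w \<in> M" "(g \<otimes> g') [^] p = g [^] p \<otimes> g' [^] p \<otimes> w"
      using class2_pow_mod[OF MG G normal_commutator_closed(1)[OF MG c G(1)]
          normal_commutator_closed(1)[OF MG c G(2)] subgroup_pow_closed[OF M.subgroup_axioms c]] ..
    then have 3: "(g \<otimes> g') [^] p \<in> M"
      using g g' by (auto simp: M1_def)
    have "\<exists>x\<in>X. inv (g \<otimes> g') \<otimes> x \<in> M"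
      using 1 X.m_closed[OF xx(1,2)] by (rule bexI)
    then show ?thesis
      using 2 3 G by (simp add: M1_def)
  qed
  have pow: "g [^] n \<in> M1" if "g \<in> M1" for g and n :: nat
  proof (induction n)
    case 0
    then show ?case using M.one_closed sub by auto
  next
    case (Suc n)
    then show ?case using mult that by simp
  qed
  obtain e where e: "order G = p ^ e" using order_prime_power by blast
  then have "order G \<noteq> 0" using prime by simp
  then have "inv g = g [^] (order G - 1)" if "g \<in> carrier G" for g
    using pow_order_eq_1[OF that] that
    by (intro inv_equality) (simp_all flip: nat_pow_Suc)
  note inv_eq = this
  have inv: "inv g \<in> M1" if "g \<in> M1" for g
  proof -
    have "g \<in> carrier G" using that by (simp add: M1_def)
    then show ?thesis using pow[OF that] by (simp add: inv_eq)
  qed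
  have conj: "g \<otimes> m \<otimes> inv g \<in> M1" if m: "m \<in> M1" and g: "g \<in> carrier G" for g m
  proof -
    have mG: "m \<in> carrier G" and "cmt m (inv g) \<in> M" using m g by (auto simp: M1_def)
    moreover have "g \<otimes> m \<otimes> inv g = m \<otimes> cmt m (inv g)"
      using mG g by (simp add: word_simps)
    ultimately show ?thesis using sub mult m by auto
  qed
  have "M1 \<lhd> G"
    unfolding normal_inv_iff
  proof (intro conjI subgroupI ballI)
    show "M1 \<subseteq> carrier G" by (auto simp: M1_def)
    show "M1 \<noteq> {}" using sub M.one_closed by blast
  qed (rule inv mult conj; assumption)+
  moreover have "x \<in> M1"
  proof -
    have "cmt x k \<in> M" if k: "k \<in> carrier G" for k
      using y(3) x(2) k xG one[of "cmt x k"] h.hom_commutator[OF xG k] h.hom_closed[OF k]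
      by (metis commutator_closed)
    moreover have "x [^] p \<in> M"
      using y(4) x(2) xG one[of "x [^] p"] h.hom_nat_pow[OF xG, of p] by (metis nat_pow_closed)
    moreover have "inv x \<otimes> x \<in> M" using xG by simp
    ultimately show ?thesis using xG x(1) unfolding M1_def mem_Collect_eq by (intro conjI ballI bexI[of _ x])
  qed
  moreover have "x \<notin> M" using x(2) y(2) xG one by metis
  \<comment> \<open>Maximality of \<open>M\<close>: a normal subgroup strictly above
    \<open>M\<close> must contain \<open>X\<close>.\<close>
  ultimately have "X \<subseteq> M1"
    using max sub M unfolding F_def by blast
  then have "X \<subseteq> M"
    using M by (intro step) (simp_all add: F_def M1_def subset_iff)
  then show False using M by (simp add: F_def)
qed

end

subsection \<open>Powerfully embedded subgroups\<close>

definition powerfully_embedded_in :: "('a, 'b) monoid_scheme \<Rightarrow> nat \<Rightarrow> 'a set \<Rightarrow> bool" where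
  "powerfully_embedded_in G p N \<longleftrightarrow>
     N \<lhd> G \<and> (\<forall>n\<in>N. \<forall>g\<in>carrier G. commutator G n g \<in> power_gen G p N)"

definition power_series :: "('a, 'b) monoid_scheme \<Rightarrow> nat \<Rightarrow> 'a set \<Rightarrow> nat \<Rightarrow> 'a set" where
  "power_series G p N m = (power_gen G p ^^ m) N"

lemma power_series_0 [simp]: "power_series G p N 0 = N"
  by (simp add: power_series_def)

lemma power_series_Suc: "power_series G p N (Suc m) = power_gen G p (power_series G p N m)"
  by (simp add: power_series_def)

context group
begin

lemma commutator_consistent:
  "\<lbrakk>subgroup K G; x \<in> K; y \<in> K\<rbrakk> \<Longrightarrow> commutator (G\<lparr>carrier := K\<rparr>) x y = cmt x y"
  by (simp add: commutator_def)

lemma power_gen_consistent: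
  assumes "subgroup K G" "A \<subseteq> K"
  shows "power_gen (G\<lparr>carrier := K\<rparr>) n A = power_gen G n A"
proof -
  have "{x [^] n | x. x \<in> A} \<subseteq> K"
    using assms subgroup_pow_closed by blast
  then show ?thesis
    using assms generate_consistent by (simp add: power_gen_def nat_pow_consistent[symmetric])
qed

lemma power_series_consistent:
  assumes "subgroup K G"
  shows "power_series (G\<lparr>carrier := K\<rparr>) p K m = power_series G p K m \<and> power_series G p K m \<subseteq> K \<and>
    subgroup (power_series G p K m) G"
proof (induction m)
  case (Suc m)
  have "{x [^] p | x. x \<in> power_series G p K m} \<subseteq> carrier G"
    using Suc subgroup.subset[OF assms] by auto
  then have "subgroup (power_gen G p (power_series G p K m)) G"
    unfolding power_gen_def by (rule generate_is_subgroup)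
  then show ?case
    using Suc power_gen_consistent[OF assms] power_gen_subset[of "power_series G p K m" p]
    by (auto simp: power_series_Suc)
qed (simp add: assms)

lemma powerfully_embedded_in_subgroup:
  assumes K: "subgroup K G" and c: "\<And>a b. a \<in> K \<Longrightarrow> b \<in> K \<Longrightarrow> cmt a b \<in> power_gen G p K"
  shows "powerfully_embedded_in (G\<lparr>carrier := K\<rparr>) p K"
proof -
  interpret K: group "G\<lparr>carrier := K\<rparr>" using K by (rule subgroup_imp_group)
  have "K \<lhd> G\<lparr>carrier := K\<rparr>"
    unfolding K.normal_inv_iff using K.subgroup_self by (simp add: subgroup.m_closed[OF K] K subgroup.m_inv_closed[OF K])
  then show ?thesis
    using c commutator_consistent[OF K] power_gen_consistent[OF K, of K]
    by (simp add: powerfully_embedded_in_def)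
qed

end

locale finite_odd_p_group = finite_p_group +
  assumes odd: "odd p"
begin

lemma subgroup_finite_odd_p_group:
  "subgroup K G \<Longrightarrow> finite_odd_p_group (G\<lparr>carrier := K\<rparr>) p"
  using subgroup_finite_p_group odd by (simp add: finite_odd_p_group_def finite_odd_p_group_axioms_def)

text \<open>Oddness of p makes the correction z^(p choose 2) of the class 2 power formula a power of
  z^p.\<close>

lemma dvd_choose_2: "p dvd (p choose 2)"
proof -
  have "p \<noteq> 2" using odd by auto
  then have "2 < p" using prime_ge_2_nat[OF prime] by simp
  then show ?thesis using prime by (intro dvd_choose_prime) auto
qed

lemma class2_pow_prime:
  assumes W: "W \<lhd> G" and G: "u \<in> carrier G" "a \<in> carrier G"
    and "cmt (cmt a u) u \<in> W" "cmt (cmt a u) a \<in> W" and z: "cmt a u [^] p \<in> W"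
  shows "\<exists>w\<in>W. (u \<otimes> a) [^] p = u [^] p \<otimes> a [^] p \<otimes> w"
proof -
  obtain m where m: "p choose 2 = p * m" using dvd_choose_2 by (rule dvdE)
  have "cmt a u [^] (p choose 2) = (cmt a u [^] p) [^] m"
    using G by (simp add: m nat_pow_pow)
  then have "cmt a u [^] (p choose 2) \<in> W"
    using subgroup_pow_closed[OF normal_imp_subgroup[OF W] z] by simp
  then show ?thesis using assms by (intro class2_pow_mod)
qed

text \<open>By \<open>commutator_pow_left\<close> the commutator equals u^(-p) (u a)^p. Modulo
  \<open>W\<close> the class 2 formula reduces it to a^p, which is trivial there.\<close>

lemma commutator_pow_prime_mem:
  assumes W: "W \<lhd> G" and G: "u \<in> carrier G" "g \<in> carrier G"
    and a: "a = cmt u g"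
    and "cmt (cmt a u) u \<in> W" "cmt (cmt a u) a \<in> W" "cmt a u [^] p \<in> W" "a [^] p \<in> W"
  shows "cmt (u [^] p) g \<in> W"
proof -
  interpret W: normal W G by fact
  have aG: "a \<in> carrier G" using G a by simp
  obtain w where w: "w \<in> W" "(u \<otimes> a) [^] p = u [^] p \<otimes> a [^] p \<otimes> w"
    using class2_pow_prime[OF W G(1) aG] assms by metis
  have "cmt (u [^] p) g = a [^] p \<otimes> w"
    using G aG w commutator_pow_left[OF G, of p] W.mem_carrier[OF w(1)]
    by (simp add: a[symmetric] m_assoc inv_mult_cancel_left)
  then show ?thesis using w(1) assms(8) by simp
qed

text \<open>By the reduction, [B,G] may be taken central of exponent p modulo \<open>M\<close>. For
  \<open>a\<close> in \<open>A\<close> put z = [a,g], an element of \<open>B\<close>; then [z,a] is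
  in [B,G], so the class 2 computation gives [a^p,g] = z^p modulo \<open>M\<close>, and z^p is in
  \<open>W\<close>. This one statement serves both the iterated power subgroups and the central
  series built from an eta-series.\<close>

lemma commutator_generate_power_mem:
  assumes A: "A \<lhd> G" and B: "B \<lhd> G" and W: "W \<lhd> G" and C: "C \<subseteq> carrier G"
    and AB: "\<And>a g. a \<in> A \<Longrightarrow> g \<in> carrier G \<Longrightarrow> cmt a g \<in> B"
    and B_eq: "B = generate G (C \<union> {a [^] p | a. a \<in> A})"
    and CW: "\<And>c g. c \<in> C \<Longrightarrow> g \<in> carrier G \<Longrightarrow> cmt c g \<in> W"
    and BW: "\<And>b. b \<in> B \<Longrightarrow> b [^] p \<in> W"
    and b: "b \<in> B" and g: "g \<in> carrier G"
  shows "cmt b g \<in> W"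
proof -
  interpret A: normal A G by fact
  interpret B: normal B G by fact
  have self: "carrier G \<lhd> G" unfolding normal_inv_iff using subgroup_self by simp
  define X where "X = commutator_gen G B (carrier G)"
  have X: "X \<lhd> G" unfolding X_def using B self by (rule commutator_gen_normal)
  have "X \<subseteq> W"
  proof (rule normal_subset_reduction[OF X W])
    fix M assume M: "M \<lhd> G" "W \<subseteq> M" and XM: "\<And>x g. x \<in> X \<Longrightarrow> g \<in> carrier G \<Longrightarrow> cmt x g \<in> M"
      and XpM: "\<And>x. x \<in> X \<Longrightarrow> x [^] p \<in> M"
    have gens: "cmt s g \<in> M" if s: "s \<in> C \<union> {a [^] p | a. a \<in> A}" and g: "g \<in> carrier G" for s g
    proof (cases "s \<in> C")
      case True
      then show ?thesis using CW g M by auto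
    next
      case False
      then obtain a where a: "a \<in> A" "s = a [^] p" using s by auto
      have aG: "a \<in> carrier G" using a A.mem_carrier by simp
      define z where "z = cmt a g"
      have z: "z \<in> B" unfolding z_def using a g by (intro AB)
      then have zX: "cmt z a \<in> X"
        unfolding X_def using aG by (rule commutator_mem_commutator_gen)
      have "cmt (a [^] p) g \<in> M"
        by (rule commutator_pow_prime_mem[OF M(1) aG g z_def])
          (use XM[OF zX aG] XM[OF zX B.mem_carrier[OF z]] XpM[OF zX] BW[OF z] M(2) in auto)
      then show ?thesis using a by simp
    qed
    have "cmt b g \<in> M" if "b \<in> B" "g \<in> carrier G" for b g
      by (rule commutator_generate_mem[OF M(1), of "C \<union> {a [^] p | a. a \<in> A}" "carrier G"])
        (use gens that C in \<open>auto simp: B_eq intro: generate.incl\<close>)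
    then show "X \<subseteq> M"
      unfolding X_def commutator_gen_def
      by (intro generate_subgroup_incl normal_imp_subgroup[OF M(1)]) auto
  qed
  then show ?thesis
    using commutator_mem_commutator_gen[OF b g] by (auto simp: X_def)
qed

lemma powerfully_embedded_in_power_gen:
  assumes "powerfully_embedded_in G p N"
  shows "powerfully_embedded_in G p (power_gen G p N)"
proof -
  have N: "N \<lhd> G" and c: "\<And>n g. n \<in> N \<Longrightarrow> g \<in> carrier G \<Longrightarrow> cmt n g \<in> power_gen G p N"
    using assms by (auto simp: powerfully_embedded_in_def)
  note P = power_gen_normal[OF N, of p]
  have "cmt b g \<in> power_gen G p (power_gen G p N)" if "b \<in> power_gen G p N" "g \<in> carrier G" for b g
    by (rule commutator_generate_power_mem[OF N P power_gen_normal[OF P, of p], of "{}"])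
      (use c that in \<open>auto simp: power_gen_def[of G p N] intro: pow_mem_power_gen\<close>)
  then show ?thesis using P by (simp add: powerfully_embedded_in_def)
qed

lemma powerfully_embedded_in_power_series:
  "powerfully_embedded_in G p N \<Longrightarrow> powerfully_embedded_in G p (power_series G p N m)"
  by (induction m) (simp_all add: power_series_Suc powerfully_embedded_in_power_gen)

lemma power_series_normal:
  "powerfully_embedded_in G p N \<Longrightarrow> power_series G p N m \<lhd> G"
  using powerfully_embedded_in_power_series[of N m] by (simp add: powerfully_embedded_in_def)

lemma power_series_commutator:
  "\<lbrakk>powerfully_embedded_in G p N; x \<in> power_series G p N m; g \<in> carrier G\<rbrakk> \<Longrightarrow>
     cmt x g \<in> power_series G p N (Suc m)"
  using powerfully_embedded_in_power_series[of N m]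
  by (simp add: powerfully_embedded_in_def power_series_Suc)

lemma power_series_Suc_subset:
  "powerfully_embedded_in G p N \<Longrightarrow> power_series G p N (Suc m) \<subseteq> power_series G p N m"
  unfolding power_series_Suc
  by (rule power_gen_subset) (rule normal_imp_subgroup[OF power_series_normal])

text \<open>Since x commutes with itself, [K,K] lies in the normal subgroup (G^p)^p, which contains
  [G^p,G] and is contained in K^p. So \<open>K\<close> is again powerful, and when proper it
  supplies the smaller group for inductions on the order.\<close>

lemma powerful_extension:
  assumes pow: "powerfully_embedded_in G p (carrier G)" and x: "x \<in> carrier G"
  defines "K \<equiv> generate G (insert x (power_gen G p (carrier G)))"
  shows "subgroup K G" "x \<in> K" "power_gen G p (carrier G) \<subseteq> K"
    "powerfully_embedded_in (G\<lparr>carrier := K\<rparr>) p K"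
    "K = carrier G \<Longrightarrow> a \<in> carrier G \<Longrightarrow> b \<in> carrier G \<Longrightarrow> cmt a b = \<one>"
proof -
  let ?P = "power_gen G p (carrier G)" and ?P2 = "power_gen G p (power_gen G p (carrier G))"
  have Pn: "?P \<lhd> G" and P2n: "?P2 \<lhd> G"
    using power_series_normal[OF pow, of "Suc 0"] power_series_normal[OF pow, of "Suc (Suc 0)"]
    by (simp_all add: power_series_Suc)
  have self: "carrier G \<lhd> G" unfolding normal_inv_iff using subgroup_self by simp
  have PG: "?P \<subseteq> carrier G" using Pn by (auto dest!: normal_imp_subgroup subgroup.subset)
  then have S: "insert x ?P \<subseteq> carrier G" using x by simp
  show K: "subgroup K G" unfolding K_def using S by (rule generate_is_subgroup)
  show "x \<in> K" unfolding K_def by (intro generate.incl) simp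
  show PK: "?P \<subseteq> K" unfolding K_def by (auto intro: generate.incl)
  have P2: "cmt s g \<in> ?P2" if "s \<in> ?P" "g \<in> carrier G" for s g
    using power_series_commutator[OF pow, of s "Suc 0" g] that by (simp add: power_series_Suc)
  have gens: "cmt s s' \<in> W"
    if W: "W \<lhd> G" and c: "\<And>s g. s \<in> ?P \<Longrightarrow> g \<in> carrier G \<Longrightarrow> cmt s g \<in> W"
      and s: "s \<in> insert x ?P" "s' \<in> insert x ?P" for s s' W
  proof -
    have G: "s \<in> carrier G" "s' \<in> carrier G" using s S by auto
    have Ws: "subgroup W G" using W by (rule normal_imp_subgroup)
    consider "s \<in> ?P" | "s' \<in> ?P" | "s = x \<and> s' = x" using s by auto
    then show ?thesis
    proof cases
      case 1
      then show ?thesis using c G by simp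
    next
      case 2
      then show ?thesis using commutator_swap_mem[OF Ws G(2,1)] c G by simp
    next
      case 3
      then show ?thesis using G subgroup.one_closed[OF Ws] by (simp add: word_simps)
    qed
  qed
  have Kc: "cmt a b \<in> W"
    if "W \<lhd> G" "\<And>s g. s \<in> ?P \<Longrightarrow> g \<in> carrier G \<Longrightarrow> cmt s g \<in> W" "a \<in> K" "b \<in> K" for a b W
    by (rule commutator_generate_mem[OF that(1) S S]) (use gens that K_def in auto)
  have "?P2 \<subseteq> power_gen G p K"
    unfolding power_gen_def[of G p K] power_gen_def[of G p ?P] using PK by (intro mono_generate) auto
  then show "powerfully_embedded_in (G\<lparr>carrier := K\<rparr>) p K"
    using Kc[OF P2n P2] by (intro powerfully_embedded_in_subgroup[OF K]) auto
  assume KG: "K = carrier G" and a: "a \<in> carrier G" and b: "b \<in> carrier G"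
  define X where "X = commutator_gen G (carrier G) (carrier G)"
  have X: "X \<lhd> G" unfolding X_def using self self by (rule commutator_gen_normal)
  \<comment> \<open>Once [G,G] is central of exponent p modulo \<open>M\<close>, p-th powers are
    central modulo \<open>M\<close>. As \<open>K\<close> is the whole group, it is then generated by
    one element and central ones modulo \<open>M\<close>, hence abelian there.\<close>
  have "X \<subseteq> {\<one>}"
  proof (rule normal_subset_reduction[OF X one_is_normal])
    fix M assume M: "M \<lhd> G" and XM: "\<And>x g. x \<in> X \<Longrightarrow> g \<in> carrier G \<Longrightarrow> cmt x g \<in> M"
      and XpM: "\<And>x. x \<in> X \<Longrightarrow> x [^] p \<in> M"
    have gens: "cmt (y [^] p) g \<in> M" if y: "y \<in> carrier G" and g: "g \<in> carrier G" for y g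
    proof -
      have X1: "cmt u v \<in> X" if "u \<in> carrier G" "v \<in> carrier G" for u v
        unfolding X_def using that by (rule commutator_mem_commutator_gen)
      have z: "cmt y g \<in> carrier G" using y g by simp
      show ?thesis
        by (rule commutator_pow_prime_mem[OF M y g refl])
          (use XM XpM X1 y g z in \<open>simp_all\<close>)
    qed
    have "cmt s g \<in> M" if "s \<in> ?P" "g \<in> carrier G" for s g
      by (rule commutator_generate_mem[OF M, of "{x [^] p | x. x \<in> carrier G}" "carrier G"])
        (use gens that in \<open>auto simp: power_gen_def intro: generate.incl\<close>)
    then have "cmt a b \<in> M" if "a \<in> carrier G" "b \<in> carrier G" for a b
      using Kc[OF M] that KG by metis
    then show "X \<subseteq> M"
      unfolding X_def commutator_gen_def
      by (intro generate_subgroup_incl normal_imp_subgroup[OF M]) auto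
  qed
  then show "cmt a b = \<one>"
    using commutator_mem_commutator_gen[OF a b] by (auto simp: X_def)
qed

end

text \<open>The point is that the p-th powers are closed under products. For g = x y one has g^p =
  x^p y^p v with v in (G^p)^p, so x^p y^p lies in K^p for K = <g, G^p>; induction on the order finds
  a root in \<open>K\<close>, unless \<open>K\<close> is everything and the group is
  abelian.\<close>

lemma powerful_pth_powers:
  fixes G :: "('a, 'b) monoid_scheme" (structure)
  assumes "finite_odd_p_group G p" "powerfully_embedded_in G p (carrier G)"
    and "w \<in> power_gen G p (carrier G)"
  shows "\<exists>g\<in>carrier G. g [^] p = w"
  using assms
proof (induction "order G" arbitrary: G w rule: less_induct)
  case (less G w)
  interpret finite_odd_p_group G p by (rule less.prems(1))
  note pow = less.prems(2)
  let ?P = "power_gen G p (carrier G)" and ?S = "{g [^]\<^bsub>G\<^esub> p | g. g \<in> carrier G}"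
  have P2: "power_gen G p ?P \<lhd> G"
    using power_series_normal[OF pow, of "Suc (Suc 0)"] by (simp add: power_series_Suc)
  have mult: "\<exists>g\<in>carrier G. x [^]\<^bsub>G\<^esub> p \<otimes>\<^bsub>G\<^esub> y [^]\<^bsub>G\<^esub> p = g [^]\<^bsub>G\<^esub> p"
    if x: "x \<in> carrier G" and y: "y \<in> carrier G" for x y
  proof -
    define g where "g = x \<otimes>\<^bsub>G\<^esub> y"
    have g: "g \<in> carrier G" using x y by (simp add: g_def)
    define K where "K = generate G (insert g ?P)"
    note K = powerful_extension[OF pow g, folded K_def]
    show ?thesis
    proof (cases "K = carrier G")
      case True
      then have "x \<otimes>\<^bsub>G\<^esub> y = y \<otimes>\<^bsub>G\<^esub> x"
        using K(5)[OF True x y] commutator_one_iff[OF x y] by metis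
      then show ?thesis
        using pow_mult_distrib[OF _ x y, of p] g by (metis g_def)
    next
      case False
      have "K \<subseteq> carrier G" using K(1) by (rule subgroup.subset)
      then have less_order: "order (G\<lparr>carrier := K\<rparr>) < order G"
        using False finite_carrier by (simp add: order_def psubset_card_mono psubset_eq)
      have c: "commutator G y x \<in> ?P"
        using pow x y by (simp add: powerfully_embedded_in_def)
      have "commutator G s h \<in> power_gen G p ?P" if "s \<in> ?P" "h \<in> carrier G" for s h
        using power_series_commutator[OF pow, of s "Suc 0" h] that by (simp add: power_series_Suc)
      then obtain v where v: "v \<in> power_gen G p ?P"
          "g [^]\<^bsub>G\<^esub> p = x [^]\<^bsub>G\<^esub> p \<otimes>\<^bsub>G\<^esub> y [^]\<^bsub>G\<^esub> p \<otimes>\<^bsub>G\<^esub> v"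
        unfolding g_def using class2_pow_prime[OF P2 x y] c pow_mem_power_gen[OF c] x y by metis
      have vG: "v \<in> carrier G" using v(1) normal_imp_subgroup[OF P2] by (metis subgroup.mem_carrier)
      have "power_gen G p ?P \<subseteq> power_gen G p K"
        unfolding power_gen_def[of G p K] power_gen_def[of G p ?P] using K(3) by (intro mono_generate) auto
      then have vK: "v \<in> power_gen G p K" using v(1) by blast
      have sub: "subgroup (power_gen G p K) G"
        using power_series_consistent[OF K(1), of p "Suc 0"] by (simp add: power_series_Suc)
      have "x [^]\<^bsub>G\<^esub> p \<otimes>\<^bsub>G\<^esub> y [^]\<^bsub>G\<^esub> p = g [^]\<^bsub>G\<^esub> p \<otimes>\<^bsub>G\<^esub> inv\<^bsub>G\<^esub> v"
        using v(2) vG x y g by (simp add: inv_solve_right)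
      also have "\<dots> \<in> power_gen G p K"
        using sub vK pow_mem_power_gen[OF K(2)] by (simp add: subgroup.m_closed subgroup.m_inv_closed)
      finally have "x [^]\<^bsub>G\<^esub> p \<otimes>\<^bsub>G\<^esub> y [^]\<^bsub>G\<^esub> p \<in> power_gen (G\<lparr>carrier := K\<rparr>) p (carrier (G\<lparr>carrier := K\<rparr>))"
        using power_gen_consistent[OF K(1), of K] by simp
      from less.hyps[OF less_order subgroup_finite_odd_p_group[OF K(1)] _ this] K(4)
      obtain k where "k \<in> K" "k [^]\<^bsub>G\<^esub> p = x [^]\<^bsub>G\<^esub> p \<otimes>\<^bsub>G\<^esub> y [^]\<^bsub>G\<^esub> p"
        by (auto simp: nat_pow_consistent[symmetric])
      then show ?thesis using \<open>K \<subseteq> carrier G\<close> by (metis subsetD)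
    qed
  qed
  have "subgroup ?S G"
  proof (rule subgroupI)
    show "?S \<subseteq> carrier G" by auto
    show "?S \<noteq> {}" by auto
    show "inv\<^bsub>G\<^esub> a \<in> ?S" if a: "a \<in> ?S" for a
    proof -
      obtain g where g: "g \<in> carrier G" "a = g [^]\<^bsub>G\<^esub> p" using a by auto
      then have "inv\<^bsub>G\<^esub> a = (inv\<^bsub>G\<^esub> g) [^]\<^bsub>G\<^esub> p" by (simp add: nat_pow_inv)
      then show ?thesis using g(1) inv_closed by blast
    qed
    show "a \<otimes>\<^bsub>G\<^esub> b \<in> ?S" if "a \<in> ?S" "b \<in> ?S" for a b
      using that mult by auto
  qed
  then have "?P \<subseteq> ?S"
    unfolding power_gen_def by (intro generate_subgroup_incl) auto
  then show ?case using less.prems(3) by auto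
qed

context finite_odd_p_group
begin

lemma pow_prime_power_pow:
  "x \<in> carrier G \<Longrightarrow> (x [^] (p ^ a)) [^] (p ^ b) = x [^] (p ^ (a + b))"
  by (simp add: nat_pow_pow power_add)

lemma pow_prime_power_Suc:
  "x \<in> carrier G \<Longrightarrow> x [^] (p ^ Suc a) = (x [^] p) [^] (p ^ a)"
  "x \<in> carrier G \<Longrightarrow> x [^] (p ^ Suc a) = (x [^] (p ^ a)) [^] p"
  by (simp_all add: nat_pow_pow mult.commute)

lemma power_series_pow_mem:
  "x \<in> power_series G p N m \<Longrightarrow> x \<in> carrier G \<Longrightarrow> x [^] (p ^ j) \<in> power_series G p N (m + j)"
proof (induction j)
  case (Suc j)
  then show ?case
    using pow_prime_power_Suc(2) pow_mem_power_gen by (simp add: power_series_Suc)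
qed simp

text \<open>Every term of the series is a powerful group in its own right, so one p-th root can be
  extracted inside each of the \<open>m\<close> terms in turn.\<close>

lemma mem_power_series_imp_power:
  assumes pe: "powerfully_embedded_in G p N" and w: "w \<in> power_series G p N m"
  shows "\<exists>n\<in>N. n [^] (p ^ m) = w"
  using w
proof (induction m arbitrary: w)
  case 0
  then show ?case
    using normal_imp_subgroup[of N G] pe subgroup.mem_carrier[of N G w]
    by (intro bexI[of _ w]) (auto simp: powerfully_embedded_in_def)
next
  case (Suc m)
  let ?K = "power_series G p N m"
  have K: "subgroup ?K G" using power_series_normal[OF pe] by (rule normal_imp_subgroup)
  have "powerfully_embedded_in (G\<lparr>carrier := ?K\<rparr>) p ?K"
    using power_series_commutator[OF pe, of _ m] subgroup.mem_carrier[OF K]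
    by (intro powerfully_embedded_in_subgroup[OF K]) (simp add: power_series_Suc)
  then obtain v where v: "v \<in> ?K" "v [^] p = w"
    using powerful_pth_powers[OF subgroup_finite_odd_p_group[OF K], of w] Suc.prems
      power_gen_consistent[OF K, of ?K]
    by (auto simp: nat_pow_consistent[symmetric] power_series_Suc)
  from Suc.IH[OF v(1)] obtain n where n: "n \<in> N" "n [^] (p ^ m) = v" by auto
  have "n \<in> carrier G"
    using n(1) pe normal_imp_subgroup[of N G] by (metis powerfully_embedded_in_def subgroup.mem_carrier)
  then have "n [^] (p ^ Suc m) = w"
    using n(2) v(2) pow_prime_power_Suc(2) by simp
  then show ?case using n(1) by auto
qed

lemma power_series_antimono:
  assumes "powerfully_embedded_in G p N" "m \<le> m'"
  shows "power_series G p N m' \<subseteq> power_series G p N m"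
  using power_series_Suc_subset[OF assms(1)] assms(2) by (rule lift_Suc_antimono_le)

lemma power_series_trivial:
  assumes "powerfully_embedded_in G p N"
  shows "\<exists>e. \<forall>m\<ge>e. power_series G p N m \<subseteq> {\<one>}"
proof -
  obtain e where e: "\<And>x. x \<in> carrier G \<Longrightarrow> x [^] (p ^ e) = \<one>"
    using ex_exponent by metis
  have "N \<subseteq> carrier G"
    using assms normal_imp_subgroup subgroup.subset by (metis powerfully_embedded_in_def)
  then have "power_series G p N e \<subseteq> {\<one>}"
    using mem_power_series_imp_power[OF assms, of _ e] e by blast
  then show ?thesis using power_series_antimono[OF assms] by blast
qed

lemma subgroup_of_bounded_order:
  assumes K: "subgroup K G"
    and closed: "\<And>x y. \<lbrakk>x \<in> K; y \<in> K; x [^] (n::nat) = \<one>; y [^] n = \<one>\<rbrakk> \<Longrightarrow> (x \<otimes> y) [^] n = \<one>"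
  shows "subgroup {x \<in> K. x [^] n = \<one>} G"
proof (rule subgroupI)
  show "{x \<in> K. x [^] n = \<one>} \<subseteq> carrier G" using subgroup.subset[OF K] by auto
  show "{x \<in> K. x [^] n = \<one>} \<noteq> {}" using subgroup.one_closed[OF K] by auto
  show "inv a \<in> {x \<in> K. x [^] n = \<one>}" if "a \<in> {x \<in> K. x [^] n = \<one>}" for a
    using that subgroup.m_inv_closed[OF K] subgroup.mem_carrier[OF K] by (simp add: nat_pow_inv)
  show "a \<otimes> b \<in> {x \<in> K. x [^] n = \<one>}"
    if "a \<in> {x \<in> K. x [^] n = \<one>}" "b \<in> {x \<in> K. x [^] n = \<one>}" for a b
    using that closed subgroup.m_closed[OF K] by simp
qed

lemma normal_subgroup_of_bounded_order:
  assumes K: "K \<lhd> G"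
    and closed: "\<And>x y. \<lbrakk>x \<in> K; y \<in> K; x [^] (n::nat) = \<one>; y [^] n = \<one>\<rbrakk> \<Longrightarrow> (x \<otimes> y) [^] n = \<one>"
  shows "{x \<in> K. x [^] n = \<one>} \<lhd> G"
  unfolding normal_inv_iff
proof (intro conjI ballI)
  interpret K: normal K G by fact
  show "subgroup {x \<in> K. x [^] n = \<one>} G"
    using K.subgroup_axioms closed by (rule subgroup_of_bounded_order)
  fix g x assume g: "g \<in> carrier G" and x: "x \<in> {x \<in> K. x [^] n = \<one>}"
  have "(g \<otimes> x \<otimes> inv g) [^] n = g \<otimes> x [^] n \<otimes> inv g"
    using conj_pow[of x "inv g" n] x g by simp
  then show "g \<otimes> x \<otimes> inv g \<in> {x \<in> K. x [^] n = \<one>}"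
    using x g K.inv_op_closed2[of g x] by simp
qed

end

text \<open>Downward induction on \<open>i\<close> in the second claim works because a commutator in the
  \<open>m\<close>-th term of the power series is a \<open>p ^ m\<close>-th power of an element whose order is larger
  by the factor \<open>p ^ m\<close>.\<close>

lemma powerful_order_mult_commutator:
  fixes G :: "('a, 'b) monoid_scheme" (structure)
  assumes "finite_odd_p_group G p" "powerfully_embedded_in G p (carrier G)"
  shows "(\<forall>i. \<forall>x\<in>carrier G. \<forall>y\<in>carrier G.
      x [^] (p ^ i) = \<one> \<longrightarrow> y [^] (p ^ i) = \<one> \<longrightarrow> (x \<otimes> y) [^] (p ^ i) = \<one>) \<and>
    (\<forall>i. \<forall>j\<le>i. \<forall>x\<in>carrier G. \<forall>y\<in>carrier G. x [^] (p ^ Suc i) = \<one> \<longrightarrow> y [^] (p ^ i) = \<one> \<longrightarrow>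
      commutator G (x [^] (p ^ j)) y [^] (p ^ (i - j)) = \<one>)"
  using assms
proof (induction "order G" arbitrary: G rule: less_induct)
  case (less G)
  interpret finite_odd_p_group G p by (rule less.prems(1))
  note pow = less.prems(2)
  let ?P = "power_gen G p (carrier G)"
  define K where "K = (\<lambda>u. generate G (insert u ?P))"
  note Kp = powerful_extension[OF pow, folded K_def]
  show ?case
  proof (cases "\<exists>u\<in>carrier G. K u = carrier G")
    case True
    then have ab: "cmt a b = \<one>\<^bsub>G\<^esub>" if "a \<in> carrier G" "b \<in> carrier G" for a b
      using Kp(5) that unfolding K_def by metis
    have "(x \<otimes>\<^bsub>G\<^esub> y) [^]\<^bsub>G\<^esub> n = x [^]\<^bsub>G\<^esub> n \<otimes>\<^bsub>G\<^esub> y [^]\<^bsub>G\<^esub> n" if "x \<in> carrier G" "y \<in> carrier G" for x y and n :: nat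
      using that ab[OF that] commutator_one_iff[OF that] pow_mult_distrib by simp
    then show ?thesis using ab by simp
  next
    case False
    \<comment> \<open>From here on every <u, G^p> is a proper powerful subgroup, so the first claim
      is known inside it.\<close>
    have clos: "(x \<otimes>\<^bsub>G\<^esub> y) [^]\<^bsub>G\<^esub> (p ^ i) = \<one>\<^bsub>G\<^esub>"
      if u: "u \<in> carrier G" and x: "x \<in> K u" "y \<in> K u"
        and o: "x [^]\<^bsub>G\<^esub> (p ^ i) = \<one>\<^bsub>G\<^esub>" "y [^]\<^bsub>G\<^esub> (p ^ i) = \<one>\<^bsub>G\<^esub>" for u x y i
    proof -
      have sub: "subgroup (K u) G" using Kp(1)[OF u] by (simp add: K_def)
      then have "K u \<subset> carrier G" using False u subgroup.subset[OF sub] by blast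
      then have "order (G\<lparr>carrier := K u\<rparr>) < order G"
        using finite_carrier by (simp add: order_def psubset_card_mono)
      from less.hyps[OF this subgroup_finite_odd_p_group[OF sub]] Kp(4)[OF u] x o
      show ?thesis by (simp add: K_def nat_pow_consistent[symmetric])
    qed
    define Q where "Q = power_series G p (carrier G)"
    have Q1: "Q (Suc 0) = ?P" by (simp add: Q_def power_series_Suc)
    have Qn: "Q m \<lhd> G" for m unfolding Q_def by (rule power_series_normal[OF pow])
    have Qs: "subgroup (Q m) G" for m using Qn by (rule normal_imp_subgroup)
    have Qc: "cmt x g \<in> Q (Suc m)" if "x \<in> Q m" "g \<in> carrier G" for x g m
      using that unfolding Q_def by (rule power_series_commutator[OF pow])
    have Qmono: "Q m' \<subseteq> Q m" if "m \<le> m'" for m m'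
      unfolding Q_def using that by (rule power_series_antimono[OF pow])
    have Qpow: "x [^]\<^bsub>G\<^esub> (p ^ j) \<in> Q (m + j)" if "x \<in> Q m" for x m j
      using power_series_pow_mem[OF that[unfolded Q_def]] subgroup.mem_carrier[OF Qs that] by (simp add: Q_def)
    have Qroot: "\<exists>n\<in>carrier G. n [^]\<^bsub>G\<^esub> (p ^ m) = w" if "w \<in> Q m" for w m
      using mem_power_series_imp_power[OF pow] that unfolding Q_def by blast
    have On: "{x \<in> Q (Suc m). x [^]\<^bsub>G\<^esub> (p ^ t) = \<one>\<^bsub>G\<^esub>} \<lhd> G" for m t
    proof (rule normal_subgroup_of_bounded_order[OF Qn])
      fix x y assume "x \<in> Q (Suc m)" "y \<in> Q (Suc m)"
        "x [^]\<^bsub>G\<^esub> (p ^ t) = \<one>\<^bsub>G\<^esub>" "y [^]\<^bsub>G\<^esub> (p ^ t) = \<one>\<^bsub>G\<^esub>"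
      moreover have "Q (Suc m) \<subseteq> K \<one>\<^bsub>G\<^esub>"
        using Qmono[of "Suc 0" "Suc m"] Kp(3)[OF one_closed] unfolding Q1 K_def by auto
      ultimately show "(x \<otimes>\<^bsub>G\<^esub> y) [^]\<^bsub>G\<^esub> (p ^ t) = \<one>\<^bsub>G\<^esub>"
        by (intro clos[of "\<one>\<^bsub>G\<^esub>"]) auto
    qed
    \<comment> \<open>[g,y] is the conjugate of y^(-1) by g times y. Both factors lie in the proper
      subgroup <y, G^p>, because the conjugate differs from y^(-1) by a commutator.\<close>
    have com_ord: "cmt g y [^]\<^bsub>G\<^esub> (p ^ i) = \<one>\<^bsub>G\<^esub>"
      if g: "g \<in> carrier G" and y: "y \<in> carrier G" and o: "y [^]\<^bsub>G\<^esub> (p ^ i) = \<one>\<^bsub>G\<^esub>" for g y i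
    proof -
      define c where "c = cmt (inv\<^bsub>G\<^esub> y) g"
      have c: "c \<in> ?P" using Qc[of "inv\<^bsub>G\<^esub> y" 0 g] g y unfolding Q1 by (simp add: c_def Q_def)
      have sub: "subgroup (K y) G" and yK: "y \<in> K y" and PK: "?P \<subseteq> K y"
        using Kp(1-3)[OF y] by (simp_all add: K_def)
      have "inv\<^bsub>G\<^esub> y \<otimes>\<^bsub>G\<^esub> c \<in> K y"
        using sub yK PK c by (auto intro: subgroup.m_closed subgroup.m_inv_closed)
      moreover have "inv\<^bsub>G\<^esub> y \<otimes>\<^bsub>G\<^esub> c = inv\<^bsub>G\<^esub> g \<otimes>\<^bsub>G\<^esub> inv\<^bsub>G\<^esub> y \<otimes>\<^bsub>G\<^esub> g"
        using g y by (simp add: c_def conj_eq_mult_commutator)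
      moreover have "(inv\<^bsub>G\<^esub> g \<otimes>\<^bsub>G\<^esub> inv\<^bsub>G\<^esub> y \<otimes>\<^bsub>G\<^esub> g) [^]\<^bsub>G\<^esub> (p ^ i) = \<one>\<^bsub>G\<^esub>"
        using g y o by (simp add: conj_pow nat_pow_inv)
      ultimately have "((inv\<^bsub>G\<^esub> g \<otimes>\<^bsub>G\<^esub> inv\<^bsub>G\<^esub> y \<otimes>\<^bsub>G\<^esub> g) \<otimes>\<^bsub>G\<^esub> y) [^]\<^bsub>G\<^esub> (p ^ i) = \<one>\<^bsub>G\<^esub>"
        using clos[OF y _ yK _ o] by simp
      then show ?thesis by (simp add: commutator_def)
    qed
    obtain e where e: "\<And>m. e \<le> m \<Longrightarrow> Q m \<subseteq> {\<one>\<^bsub>G\<^esub>}"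
      using power_series_trivial[OF pow] unfolding Q_def by metis
    have com_pow: "cmt (x [^]\<^bsub>G\<^esub> (p ^ j)) y [^]\<^bsub>G\<^esub> (p ^ (i - j)) = \<one>\<^bsub>G\<^esub>"
      if "j \<le> i" "x \<in> carrier G" "y \<in> carrier G"
        "x [^]\<^bsub>G\<^esub> (p ^ Suc i) = \<one>\<^bsub>G\<^esub>" "y [^]\<^bsub>G\<^esub> (p ^ i) = \<one>\<^bsub>G\<^esub>" for i j x y
      using that
    proof (induction "e - i" arbitrary: i j x y rule: less_induct)
      case (less i j x y)
      note x = less.prems(2) and y = less.prems(3) and ox = less.prems(4) and oy = less.prems(5)
      show ?case
      proof (cases "e \<le> Suc i")
        \<comment> \<open>The commutator lies in \<open>Q (Suc j)\<close>, so its p^(i-j)-th power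
          lies in \<open>Q (Suc i)\<close>, which is already trivial.\<close>
        case True
        have "x [^]\<^bsub>G\<^esub> (p ^ j) \<in> Q (0 + j)" using x by (intro Qpow) (simp add: Q_def)
        then have "cmt (x [^]\<^bsub>G\<^esub> (p ^ j)) y [^]\<^bsub>G\<^esub> (p ^ (i - j)) \<in> Q (Suc j + (i - j))"
          using y by (intro Qpow Qc) simp_all
        then show ?thesis using e[of "Suc i"] True less.prems(1) by auto
      next
        case False
        then have IH: "cmt (d [^]\<^bsub>G\<^esub> (p ^ j)) v [^]\<^bsub>G\<^esub> (p ^ (Suc i - j)) = \<one>\<^bsub>G\<^esub>"
          if "j \<le> Suc i" "d \<in> carrier G" "v \<in> carrier G"
            "d [^]\<^bsub>G\<^esub> (p ^ Suc (Suc i)) = \<one>\<^bsub>G\<^esub>" "v [^]\<^bsub>G\<^esub> (p ^ Suc i) = \<one>\<^bsub>G\<^esub>" for d v j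
          using that by (intro less.hyps) auto
        show ?thesis using less.prems(1)
        proof (induction j)
          case 0
          then show ?case using com_ord[OF x y oy] x by simp
        next
          case (Suc j)
          define u where "u = x [^]\<^bsub>G\<^esub> (p ^ j)"
          have u: "u \<in> carrier G" using x by (simp add: u_def)
          have uQ: "u \<in> Q (0 + j)" unfolding u_def using x by (intro Qpow) (simp add: Q_def)
          define a where "a = cmt u y"
          have aQ: "a \<in> Q (Suc j)" unfolding a_def using uQ y by (intro Qc) simp_all
          have a: "a \<in> carrier G" using u y by (simp add: a_def)
          have ij: "i - j = Suc (i - Suc j)" using Suc.prems by simp
          have oa: "a [^]\<^bsub>G\<^esub> (p ^ Suc (i - Suc j)) = \<one>\<^bsub>G\<^esub>"
            using Suc.IH Suc.prems unfolding a_def u_def ij[symmetric] by simp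
          \<comment> \<open>The target for [u^p,y]: compared with [u,y], its order has to drop by
            one factor p. Normality holds since \<open>Q (Suc j)\<close> lies in <1, G^p>, where
            orders are known to behave well.\<close>
          define W where "W = {x \<in> Q (Suc j). x [^]\<^bsub>G\<^esub> (p ^ (i - Suc j)) = \<one>\<^bsub>G\<^esub>}"
          have W: "W \<lhd> G" unfolding W_def by (rule On)
          have pW: "b [^]\<^bsub>G\<^esub> p \<in> W" if "b \<in> Q (Suc j)" "b [^]\<^bsub>G\<^esub> (p ^ Suc (i - Suc j)) = \<one>\<^bsub>G\<^esub>" for b
            using that subgroup_pow_closed[OF Qs that(1)] pow_prime_power_Suc(1)[of b "i - Suc j"]
              subgroup.mem_carrier[OF Qs that(1)] unfolding W_def by simp
          define z where "z = cmt a u"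
          have z: "z \<in> carrier G" using a u by (simp add: z_def)
          have zQ: "z \<in> Q (Suc (Suc j))" unfolding z_def using aQ u by (rule Qc)
          have oz: "z [^]\<^bsub>G\<^esub> (p ^ Suc (i - Suc j)) = \<one>\<^bsub>G\<^esub>"
            using com_ord[OF u a oa] commutator_swap[OF u a] u a by (simp add: z_def nat_pow_inv)
          \<comment> \<open>z lies two terms below \<open>u\<close>, hence is a p^(j+2)-th power of
            some d with d^(p^(i+2)) = 1. The outer hypothesis at i+1 for d bounds [z,v] by
            p^((i+1)-(j+2)), exactly the exponent in \<open>W\<close>.\<close>
          obtain d where d: "d \<in> carrier G" "d [^]\<^bsub>G\<^esub> (p ^ Suc (Suc j)) = z"
            using Qroot[OF zQ] by blast
          have od: "d [^]\<^bsub>G\<^esub> (p ^ Suc (Suc i)) = \<one>\<^bsub>G\<^esub>"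
          proof -
            have "Suc (Suc i) = Suc (Suc j) + Suc (i - Suc j)" using Suc.prems by simp
            then show ?thesis using pow_prime_power_pow[OF d(1), of "Suc (Suc j)" "Suc (i - Suc j)"] oz d(2) by metis
          qed
          have zW: "cmt z v \<in> W" if v: "v \<in> carrier G" "v [^]\<^bsub>G\<^esub> (p ^ Suc i) = \<one>\<^bsub>G\<^esub>" for v
          proof -
            have "cmt z v \<in> Q (Suc j)"
              using Qc[OF zQ v(1)] Qmono[of "Suc j" "Suc (Suc (Suc j))"] by auto
            moreover have "cmt z v [^]\<^bsub>G\<^esub> (p ^ (Suc i - Suc (Suc j))) = \<one>\<^bsub>G\<^esub>"
              using IH[of "Suc (Suc j)" d v] Suc.prems d od v by simp
            ultimately show ?thesis by (simp add: W_def)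
          qed
          have ou: "u [^]\<^bsub>G\<^esub> (p ^ Suc i) = \<one>\<^bsub>G\<^esub>"
          proof -
            have "u [^]\<^bsub>G\<^esub> (p ^ Suc i) = (x [^]\<^bsub>G\<^esub> (p ^ Suc i)) [^]\<^bsub>G\<^esub> (p ^ j)"
              using pow_prime_power_pow[OF x, of j "Suc i"] pow_prime_power_pow[OF x, of "Suc i" j]
              by (simp add: u_def add.commute del: power_Suc)
            then show ?thesis using ox by simp
          qed
          have oa': "a [^]\<^bsub>G\<^esub> (p ^ Suc i) = \<one>\<^bsub>G\<^esub>"
          proof -
            have "Suc i = Suc (i - Suc j) + Suc j" using Suc.prems by simp
            then show ?thesis
              using pow_prime_power_pow[OF a, of "Suc (i - Suc j)" "Suc j"] oa by (metis nat_pow_one)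
          qed
          have "cmt (u [^]\<^bsub>G\<^esub> p) y \<in> W"
            by (rule commutator_pow_prime_mem[OF W u y a_def])
              (use zW[OF u ou] zW[OF a oa'] pW[OF aQ oa] pW[of z] zQ Qmono[of "Suc j" "Suc (Suc j)"] oz in
                \<open>auto simp: z_def\<close>)
          then show ?case
            using pow_prime_power_Suc(2)[OF x, of j] by (simp add: W_def u_def)
        qed
      qed
    qed
    have "(x \<otimes>\<^bsub>G\<^esub> y) [^]\<^bsub>G\<^esub> (p ^ i) = \<one>\<^bsub>G\<^esub>"
      if "x \<in> carrier G" "y \<in> carrier G" "x [^]\<^bsub>G\<^esub> (p ^ i) = \<one>\<^bsub>G\<^esub>" "y [^]\<^bsub>G\<^esub> (p ^ i) = \<one>\<^bsub>G\<^esub>" for i x y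
      using that
    proof (induction i arbitrary: x y)
      case (Suc i)
      note x = Suc.prems(1) and y = Suc.prems(2) and ox = Suc.prems(3) and oy = Suc.prems(4)
      define V where "V = {g \<in> carrier G. g [^]\<^bsub>G\<^esub> (p ^ i) = \<one>\<^bsub>G\<^esub>}"
      have V: "V \<lhd> G" unfolding V_def
        by (rule normal_subgroup_of_bounded_order) (use Suc.IH Qn[of 0] in \<open>auto simp: Q_def\<close>)
      have pV: "b [^]\<^bsub>G\<^esub> p \<in> V" if "b \<in> carrier G" "b [^]\<^bsub>G\<^esub> (p ^ Suc i) = \<one>\<^bsub>G\<^esub>" for b
        using that pow_prime_power_Suc(1)[of b i] by (simp add: V_def)
      define z where "z = cmt y x"
      have zQ: "z \<in> Q (Suc 0)" unfolding z_def using x y by (intro Qc) (simp_all add: Q_def)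
      have z: "z \<in> carrier G" using x y by (simp add: z_def)
      have oz: "z [^]\<^bsub>G\<^esub> (p ^ Suc i) = \<one>\<^bsub>G\<^esub>"
        unfolding z_def using y x ox by (rule com_ord)
      \<comment> \<open>The same exchange with one root: [z,v] = [d^p,v] has order dividing p^i by
        \<open>com_pow\<close> at i+1, so (x y)^p can be computed in class 2 modulo
        \<open>V\<close>.\<close>
      obtain d where d: "d \<in> carrier G" "d [^]\<^bsub>G\<^esub> (p ^ Suc 0) = z"
        using Qroot[OF zQ] by blast
      have od: "d [^]\<^bsub>G\<^esub> (p ^ Suc (Suc i)) = \<one>\<^bsub>G\<^esub>"
        using pow_prime_power_pow[OF d(1), of "Suc 0" "Suc i"] oz d(2) by simp
      have zV: "cmt z v \<in> V" if "v \<in> carrier G" "v [^]\<^bsub>G\<^esub> (p ^ Suc i) = \<one>\<^bsub>G\<^esub>" for v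
        using com_pow[of "Suc 0" "Suc i" d v] d od that z unfolding V_def by (simp del: power_Suc)
      obtain w where w: "w \<in> V" "(x \<otimes>\<^bsub>G\<^esub> y) [^]\<^bsub>G\<^esub> p = x [^]\<^bsub>G\<^esub> p \<otimes>\<^bsub>G\<^esub> y [^]\<^bsub>G\<^esub> p \<otimes>\<^bsub>G\<^esub> w"
        using class2_pow_prime[OF V x y] zV[OF x ox] zV[OF y oy] pV[OF z oz] unfolding z_def by metis
      then have "(x \<otimes>\<^bsub>G\<^esub> y) [^]\<^bsub>G\<^esub> p \<in> V"
        using pV[OF x ox] pV[OF y oy] normal_imp_subgroup[OF V] by (simp add: subgroup.m_closed)
      then show ?case
        using pow_prime_power_Suc(1)[of "x \<otimes>\<^bsub>G\<^esub> y" i] x y by (simp add: V_def)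
    qed simp
    then show ?thesis using com_pow by blast
  qed
qed

subsection \<open>Polynomial sequences and the Hall--Petrescu formula\<close>

text \<open>The j-th discrete derivative, for j up to \<open>d\<close>, takes values in
  \<open>K (i + j)\<close>. Truncating at depth \<open>d\<close> permits induction; a polynomial
  sequence proper satisfies this for every \<open>d\<close>.\<close>

primrec polynomial_seq ::
    "('a, 'b) monoid_scheme \<Rightarrow> (nat \<Rightarrow> 'a set) \<Rightarrow> nat \<Rightarrow> nat \<Rightarrow> (nat \<Rightarrow> 'a) \<Rightarrow> bool" where
  "polynomial_seq G K 0 i f \<longleftrightarrow> (\<forall>n. f n \<in> K i)"
| "polynomial_seq G K (Suc d) i f \<longleftrightarrow>
     (\<forall>n. f n \<in> K i) \<and> polynomial_seq G K d (Suc i) (\<lambda>n. inv\<^bsub>G\<^esub> (f n) \<otimes>\<^bsub>G\<^esub> f (Suc n))"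

locale commutator_filtration = group +
  fixes K :: "nat \<Rightarrow> 'a set"
  assumes filtration_subgroup: "subgroup (K i) G"
    and filtration_Suc: "K (Suc i) \<subseteq> K i"
    and filtration_commutator: "x \<in> K i \<Longrightarrow> y \<in> K j \<Longrightarrow> cmt x y \<in> K (i + j)"
begin

abbreviation pol :: "nat \<Rightarrow> nat \<Rightarrow> (nat \<Rightarrow> 'a) \<Rightarrow> bool" where
  "pol \<equiv> polynomial_seq G K"

lemma filtration_antimono: "i \<le> j \<Longrightarrow> K j \<subseteq> K i"
  using filtration_Suc by (rule lift_Suc_antimono_le)

lemma filtration_carrier: "x \<in> K i \<Longrightarrow> x \<in> carrier G"
  using filtration_subgroup by (rule subgroup.mem_carrier)

lemma pol_value: "pol d i f \<Longrightarrow> f n \<in> K i"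
  by (cases d) simp_all

lemma pol_carrier: "pol d i f \<Longrightarrow> f n \<in> carrier G"
  by (rule filtration_carrier) (rule pol_value)

lemma pol_depth_Suc: "pol (Suc d) i f \<Longrightarrow> pol d i f"
proof (induction d arbitrary: i f)
  case (Suc d)
  have "pol (Suc d) (Suc i) (\<lambda>n. inv f n \<otimes> f (Suc n))"
    using Suc.prems by (simp only: polynomial_seq.simps(2)[of G K "Suc d"])
  from Suc.IH[OF this] show ?case using pol_value[OF Suc.prems] by simp
qed simp

lemma pol_mono: "pol d i f \<Longrightarrow> j \<le> i \<Longrightarrow> pol d j f"
proof (induction d arbitrary: i j f)
  case 0
  then show ?case using filtration_antimono by auto
next
  case (Suc d)
  then show ?case using filtration_antimono[OF Suc.prems(2)] by auto
qed

text \<open>A truncated form of the Lazard-Leibman theorem. The three claims need each other: with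
  f', g' the derivatives, that of f g is f' [f',g] g', and that of [f,g] is a product of commutators
  each involving f' or g'. Commutators with a derivative gain the extra filtration step.\<close>

lemma pol_closed:
  "(\<forall>i f g. pol d i f \<longrightarrow> pol d i g \<longrightarrow> pol d i (\<lambda>n. f n \<otimes> g n)) \<and>
   (\<forall>i f. pol d i f \<longrightarrow> pol d i (\<lambda>n. inv (f n))) \<and>
   (\<forall>i j f g. pol d i f \<longrightarrow> pol d j g \<longrightarrow> pol d (i + j) (\<lambda>n. cmt (f n) (g n)))"
proof (induction d)
  case 0
  show ?case
    using filtration_commutator subgroup.m_closed[OF filtration_subgroup]
      subgroup.m_inv_closed[OF filtration_subgroup] by simp
next
  case (Suc d)
  have mult: "pol d i (\<lambda>n. f n \<otimes> g n)" if "pol d i f" "pol d i g" for i f g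
    using that by (rule Suc[THEN conjunct1, rule_format])
  have inv: "pol d i (\<lambda>n. inv (f n))" if "pol d i f" for i f
    using that by (rule Suc[THEN conjunct2, THEN conjunct1, rule_format])
  have com: "pol d m (\<lambda>n. cmt (f n) (g n))" if "pol d i f" "pol d j g" "m \<le> i + j" for i j m f g
    using Suc[THEN conjunct2, THEN conjunct2, rule_format, OF that(1,2)] that(3) by (rule pol_mono)
  have 1: "pol (Suc d) i (\<lambda>n. f n \<otimes> g n)" if f: "pol (Suc d) i f" and g: "pol (Suc d) i g" for i f g
  proof -
    define f' g' where "f' = (\<lambda>n. inv (f n) \<otimes> f (Suc n))" and "g' = (\<lambda>n. inv (g n) \<otimes> g (Suc n))"
    have d: "pol d (Suc i) f'" "pol d (Suc i) g'" using f g by (simp_all add: f'_def g'_def)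
    have "pol d (Suc i) (\<lambda>n. f' n \<otimes> cmt (f' n) (g n) \<otimes> g' n)"
      by (intro mult d com[OF d(1) pol_depth_Suc[OF g]]) simp
    moreover have "inv (f n \<otimes> g n) \<otimes> (f (Suc n) \<otimes> g (Suc n)) = f' n \<otimes> cmt (f' n) (g n) \<otimes> g' n" for n
      using pol_carrier[OF f] pol_carrier[OF g] by (simp add: f'_def g'_def word_simps)
    ultimately show ?thesis
      using pol_value[OF f] pol_value[OF g] subgroup.m_closed[OF filtration_subgroup] by simp
  qed
  have 2: "pol (Suc d) i (\<lambda>n. inv (f n))" if f: "pol (Suc d) i f" for i f
  proof -
    define f' where "f' = (\<lambda>n. inv (f n) \<otimes> f (Suc n))"
    have d: "pol d (Suc i) (\<lambda>n. inv (f' n))" using f inv by (simp add: f'_def)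
    have "pol d (Suc i) (\<lambda>n. inv (f' n) \<otimes> cmt (inv (f' n)) (inv (f n)))"
      by (intro mult d com[OF d inv[OF pol_depth_Suc[OF f]]]) simp
    moreover have "inv (inv (f n)) \<otimes> inv (f (Suc n)) = inv (f' n) \<otimes> cmt (inv (f' n)) (inv (f n))" for n
      using pol_carrier[OF f] by (simp add: f'_def word_simps)
    ultimately show ?thesis
      using pol_value[OF f] subgroup.m_inv_closed[OF filtration_subgroup] by simp
  qed
  have 3: "pol (Suc d) (i + j) (\<lambda>n. cmt (f n) (g n))"
    if f: "pol (Suc d) i f" and g: "pol (Suc d) j g" for i j f g
  proof -
    define f' g' c where "f' = (\<lambda>n. inv (f n) \<otimes> f (Suc n))" and "g' = (\<lambda>n. inv (g n) \<otimes> g (Suc n))"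
      and "c = (\<lambda>n. cmt (f n) (g n))"
    define t where "t = (\<lambda>n. cmt (f n \<otimes> c n) (g' n))"
    have d: "pol d (Suc i) f'" "pol d (Suc j) g'" using f g by (simp_all add: f'_def g'_def)
    note f0 = pol_depth_Suc[OF f] and g0 = pol_depth_Suc[OF g]
    have c: "pol d (i + j) c" unfolding c_def using f0 g0 by (rule com) simp
    have t: "pol d (Suc (i + j)) t" unfolding t_def
      by (rule com[OF mult[OF f0 pol_mono[OF c]] d(2)]) simp_all
    have ct: "pol d (i + j) (\<lambda>n. c n \<otimes> t n)"
      by (rule mult[OF c pol_mono[OF t]]) simp
    have gg: "pol d j (\<lambda>n. g n \<otimes> g' n)"
      by (rule mult[OF g0 pol_mono[OF d(2)]]) simp
    have "pol d (Suc (i + j)) (\<lambda>n. t n \<otimes> cmt (c n \<otimes> t n) (f' n) \<otimes> cmt (f' n) (g n \<otimes> g' n))"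
      by (intro mult t com[OF ct d(1)] com[OF d(1) gg]) simp_all
    moreover have "inv (cmt (f n) (g n)) \<otimes> cmt (f (Suc n)) (g (Suc n)) =
        t n \<otimes> cmt (c n \<otimes> t n) (f' n) \<otimes> cmt (f' n) (g n \<otimes> g' n)" for n
      using pol_carrier[OF f] pol_carrier[OF g] by (simp add: f'_def g'_def c_def t_def word_simps)
    ultimately show ?thesis
      using pol_value[OF f] pol_value[OF g] filtration_commutator by simp
  qed
  show ?case using 1 2 3 by blast
qed

lemma pol_one: "pol d i (\<lambda>n. \<one>)"
  by (induction d arbitrary: i) (simp_all add: subgroup.one_closed[OF filtration_subgroup])

text \<open>Pascal's rule: the derivative of c^(n choose s) is c^(n choose (s-1)). The degree bound
  \<open>i\<close> goes up as s goes down, so \<open>i + s\<close> is preserved.\<close>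

lemma pol_pow_choose: "c \<in> K (i + s) \<Longrightarrow> pol d i (\<lambda>n. c [^] (n choose s))"
proof (induction d arbitrary: i s)
  case 0
  then show ?case
    using filtration_antimono[of i "i + s"] subgroup_pow_closed[OF filtration_subgroup] by auto
next
  case (Suc d)
  have c: "c \<in> carrier G" using Suc.prems by (rule filtration_carrier)
  have "pol d (Suc i) (\<lambda>n. inv (c [^] (n choose s)) \<otimes> c [^] (Suc n choose s))"
  proof (cases s)
    case 0
    then show ?thesis using c pol_one by simp
  next
    case (Suc s')
    have "inv (c [^] (n choose s)) \<otimes> c [^] (Suc n choose s) = c [^] (n choose s')" for n
    proof -
      have "c [^] (Suc n choose s) = c [^] (n choose s) \<otimes> c [^] (n choose s')"
        using c by (simp add: Suc nat_pow_mult add.commute)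
      then show ?thesis using c by (simp add: inv_mult_cancel_left)
    qed
    then show ?thesis using Suc.IH[of "Suc i" s'] Suc.prems Suc by simp
  qed
  then show ?case
    using filtration_antimono[of i "i + s"] subgroup_pow_closed[OF filtration_subgroup] Suc.prems by auto
qed

text \<open>After trivial values at 0, ..., s-1, the value at s equals the s-th derivative at
  0.\<close>

lemma pol_first_nonzero: "pol s i f \<Longrightarrow> (\<And>n. n < s \<Longrightarrow> f n = \<one>) \<Longrightarrow> f s \<in> K (i + s)"
proof (induction s arbitrary: i f)
  case (Suc s)
  have "inv (f s) \<otimes> f (Suc s) \<in> K (Suc i + s)"
  proof (rule Suc.IH)
    show "pol s (Suc i) (\<lambda>n. inv (f n) \<otimes> f (Suc n))" using Suc.prems(1) by simp
    show "inv (f n) \<otimes> f (Suc n) = \<one>" if "n < s" for n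
      using Suc.prems(2)[of n] Suc.prems(2)[of "Suc n"] that by simp
  qed
  then show ?case using Suc.prems(2)[of s] pol_carrier[OF Suc.prems(1)] by simp
qed simp

text \<open>The sequence \<open>h\<^sup>-\<^sup>m g\<^sup>-\<^sup>m (g h)\<^sup>m\<close> is polynomial, hence has a Taylor expansion with factors
  \<open>c\<^sub>s\<close> in \<open>K s\<close> raised to the power \<open>m choose s\<close>. This is the Hall--Petrescu formula.\<close>

lemma hall_petrescu_trivial:
  assumes g: "g \<in> K 1" and h: "h \<in> K 1"
    and triv: "\<And>s z. \<lbrakk>2 \<le> s; s \<le> n; z \<in> K s\<rbrakk> \<Longrightarrow> z [^] (n choose s) = \<one>"
  shows "(g \<otimes> h) [^] n = g [^] n \<otimes> h [^] n"
proof (cases "n = 0")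
  case False
  note mult = pol_closed[THEN conjunct1, rule_format]
  note inv = pol_closed[THEN conjunct2, THEN conjunct1, rule_format]
  have G: "g \<in> carrier G" "h \<in> carrier G" using g h by (auto intro: filtration_carrier)
  have pow: "pol d 0 (\<lambda>m. c [^] m)" if "c \<in> K 1" for c d
    using pol_pow_choose[of c 0 1 d] that by simp
  have gh: "g \<otimes> h \<in> K 1" using g h by (rule subgroup.m_closed[OF filtration_subgroup])
  define f0 where "f0 = (\<lambda>m::nat. inv (h [^] m) \<otimes> inv (g [^] m) \<otimes> (g \<otimes> h) [^] m)"
  \<comment> \<open>Taylor coefficients are removed one by one. The start is 2 because
    \<open>f0\<close> is trivial at 0 and 1; by \<open>triv\<close> each removed factor is trivial
    at the argument \<open>n\<close>, so the value there never changes and is seen to be 1 once the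
    sequence vanishes up to \<open>n\<close>.\<close>
  have "2 \<le> s \<Longrightarrow> s \<le> Suc n \<Longrightarrow> \<exists>f. (\<forall>d. pol d 0 f) \<and> (\<forall>m<s. f m = \<one>) \<and> f n = f0 n" for s
  proof (induction s rule: dec_induct)
    case base
    have "f0 m = \<one>" if "m < 2" for m
    proof -
      have "m = 0 \<or> m = 1" using that by auto
      then show ?thesis using G by (auto simp: f0_def word_simps)
    qed
    moreover have "pol d 0 f0" for d
      unfolding f0_def by (intro mult inv pow g h gh)
    ultimately show ?case by blast
  next
    case (step s)
    then obtain f where f: "\<And>d. pol d 0 f" "\<And>m. m < s \<Longrightarrow> f m = \<one>" "f n = f0 n"
      by auto
    define c where "c = f s"
    have c: "c \<in> K s" using pol_first_nonzero[OF f(1), of s] f(2) by (simp add: c_def)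
    have cG: "c \<in> carrier G" using c by (rule filtration_carrier)
    define f' where "f' = (\<lambda>m. f m \<otimes> inv (c [^] (m choose s)))"
    have "pol d 0 f'" for d
      unfolding f'_def using c by (intro mult inv f pol_pow_choose) simp
    moreover have "f' m = \<one>" if "m < Suc s" for m
    proof (cases "m = s")
      case True
      then show ?thesis using cG by (simp add: f'_def c_def)
    next
      case False
      then have "m < s" using that by simp
      then show ?thesis using f(2) cG by (simp add: f'_def binomial_eq_0)
    qed
    moreover have "f' n = f0 n"
      using triv[OF step(1) _ c] step(4) f(3) pol_carrier[OF f(1), of n] by (simp add: f'_def)
    ultimately show ?case by blast
  qed
  from this[of "Suc n"] False have "f0 n = \<one>" by auto
  then have "inv (g [^] n \<otimes> h [^] n) \<otimes> (g \<otimes> h) [^] n = \<one>"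
    using G by (simp add: f0_def inv_mult_group)
  then show ?thesis
    using G inv_mult_cancel_left(2)[of "g [^] n \<otimes> h [^] n" "(g \<otimes> h) [^] n"] by simp
qed simp

end

subsection \<open>Lower central series\<close>

text \<open>Indices start at 0: the term at \<open>r\<close> is gamma_{r+1}(H) in the usual
  numbering.\<close>

primrec lower_central :: "('a, 'b) monoid_scheme \<Rightarrow> 'a set \<Rightarrow> nat \<Rightarrow> 'a set" where
  "lower_central G H 0 = H"
| "lower_central G H (Suc r) = commutator_gen G (lower_central G H r) H"

context group
begin

lemma hall_witt:
  assumes "x \<in> carrier G" "y \<in> carrier G" "z \<in> carrier G"
  shows "(inv y \<otimes> cmt (cmt x (inv y)) z \<otimes> y) \<otimes> (inv z \<otimes> cmt (cmt y (inv z)) x \<otimes> z) \<otimes>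
    (inv x \<otimes> cmt (cmt z (inv x)) y \<otimes> x) = \<one>"
  using assms by (simp add: word_simps)

text \<open>In the Hall-Witt identity for a, b and the inverse of c two factors lie in
  \<open>W\<close> by hypothesis, hence so does the third, a conjugate of the desired commutator.
  The hypotheses range over whole subgroups, so inverses may be substituted.\<close>

lemma three_subgroups:
  assumes W: "W \<lhd> G" and sub: "subgroup A G" "subgroup B G" "subgroup C G"
    and 1: "\<And>a b c. \<lbrakk>a \<in> A; b \<in> B; c \<in> C\<rbrakk> \<Longrightarrow> cmt (cmt a b) c \<in> W"
    and 2: "\<And>a b c. \<lbrakk>a \<in> A; b \<in> B; c \<in> C\<rbrakk> \<Longrightarrow> cmt (cmt c a) b \<in> W"
    and abc: "a \<in> A" "b \<in> B" "c \<in> C"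
  shows "cmt (cmt b c) a \<in> W"
proof -
  interpret W: normal W G by fact
  have G: "a \<in> carrier G" "b \<in> carrier G" "c \<in> carrier G"
    using abc sub by (auto intro: subgroup.mem_carrier)
  define u where "u = inv b \<otimes> cmt (cmt a (inv b)) (inv c) \<otimes> b"
  define v where "v = c \<otimes> cmt (cmt b c) a \<otimes> inv c"
  define w where "w = inv a \<otimes> cmt (cmt (inv c) (inv a)) b \<otimes> a"
  have inv: "inv a \<in> A" "inv b \<in> B" "inv c \<in> C"
    using abc sub by (auto intro: subgroup.m_inv_closed)
  have uW: "u \<in> W" and wW: "w \<in> W"
    unfolding u_def w_def using 1[OF abc(1) inv(2,3)] 2[OF inv(1) abc(2) inv(3)] G
    by (auto intro: normal_conj_closed[OF W])
  have vG: "v \<in> carrier G" using G by (simp add: v_def)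
  have "u \<otimes> v \<otimes> w = \<one>"
    using hall_witt[of a b "inv c"] G by (simp add: u_def v_def w_def)
  then have "v = inv u \<otimes> inv w"
    using vG W.mem_carrier[OF uW] W.mem_carrier[OF wW]
    by (metis inv_equality inv_inv inv_mult_group inv_solve_left' m_assoc m_closed r_one inv_closed)
  then have "v \<in> W" using uW wW by simp
  then have "inv c \<otimes> v \<otimes> c \<in> W" using G by (intro normal_conj_closed[OF W])
  moreover have "inv c \<otimes> v \<otimes> c = cmt (cmt b c) a"
    unfolding v_def using G by (simp add: m_assoc inv_mult_cancel_left)
  ultimately show ?thesis by simp
qed

lemma lower_central_normal: "H \<lhd> G \<Longrightarrow> lower_central G H r \<lhd> G"
  by (induction r) (simp_all add: commutator_gen_normal)

lemma lower_central_Suc_subset: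
  assumes "H \<lhd> G"
  shows "lower_central G H (Suc r) \<subseteq> lower_central G H r"
proof -
  note L = lower_central_normal[OF assms, of r]
  have "{cmt x y | x y. x \<in> lower_central G H r \<and> y \<in> H} \<subseteq> lower_central G H r"
    using normal_commutator_closed(1)[OF L] subgroup.mem_carrier[OF normal_imp_subgroup[OF assms]] by blast
  then show ?thesis
    using normal_imp_subgroup[OF L] by (simp add: commutator_gen_def generate_subgroup_incl)
qed

lemma lower_central_antimono:
  "H \<lhd> G \<Longrightarrow> r \<le> s \<Longrightarrow> lower_central G H s \<subseteq> lower_central G H r"
  using lift_Suc_antimono_le[where f = "lower_central G H"] lower_central_Suc_subset by simp

text \<open>The inclusion [gamma_m, gamma_n] <= gamma_{m+n} with both indices shifted by one, whence
  the \<open>Suc\<close>. Induction on \<open>b\<close> splits [u,h] by the three subgroups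
  lemma.\<close>

lemma lower_central_commutator:
  assumes H: "H \<lhd> G"
  shows "x \<in> lower_central G H a \<Longrightarrow> y \<in> lower_central G H b \<Longrightarrow>
    cmt x y \<in> lower_central G H (Suc (a + b))"
proof (induction b arbitrary: a x y)
  case 0
  then show ?case by (simp add: commutator_mem_commutator_gen)
next
  case (Suc b)
  let ?L = "lower_central G H" and ?W = "lower_central G H (Suc (a + Suc b))"
  have W: "?W \<lhd> G" using H by (rule lower_central_normal)
  have sub: "subgroup (?L r) G" for r using lower_central_normal[OF H] by (rule normal_imp_subgroup)
  have Hs: "subgroup H G" using H by (rule normal_imp_subgroup)
  have xG: "x \<in> carrier G" and yG: "y \<in> carrier G"
    using Suc.prems sub subgroup.mem_carrier by metis+
  have "cmt (cmt u h) x' \<in> ?W" if "u \<in> ?L b" "h \<in> H" "x' \<in> ?L a" for u h x'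
  proof (rule three_subgroups[OF W sub[of a] sub[of b] Hs])
    show "cmt (cmt x u) h \<in> ?W" if "x \<in> ?L a" "u \<in> ?L b" "h \<in> H" for x u h
      using Suc.IH[OF that(1,2)] that(3) by (simp add: commutator_mem_commutator_gen)
    show "cmt (cmt h x) u \<in> ?W" if "x \<in> ?L a" "u \<in> ?L b" "h \<in> H" for x u h
    proof -
      have "cmt x h \<in> ?L (Suc a)" using that by (simp add: commutator_mem_commutator_gen)
      then have "cmt h x \<in> ?L (Suc a)"
        using commutator_swap_mem[OF sub] subgroup.mem_carrier[OF sub that(1)]
          subgroup.mem_carrier[OF Hs that(3)] by blast
      from Suc.IH[OF this that(2)] show ?thesis by simp
    qed
  qed (use that in auto)
  then have gens: "cmt s x \<in> ?W" if "s \<in> {cmt u h | u h. u \<in> ?L b \<and> h \<in> H}" for s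
    using that Suc.prems(1) by blast
  have "cmt y x \<in> ?W"
    by (rule commutator_generate_mem[OF W, of "{cmt u h | u h. u \<in> ?L b \<and> h \<in> H}" "{x}"])
      (use gens xG Suc.prems(2) subgroup.mem_carrier[OF sub] subgroup.mem_carrier[OF Hs] in
        \<open>auto simp: commutator_gen_def intro: generate.incl\<close>)
  then show ?case using commutator_swap_mem[OF normal_imp_subgroup[OF W] yG xG] by simp
qed

end

section \<open>Commutators of a powerfully embedded subgroup with outside elements\<close>

context finite_odd_p_group
begin

text \<open>As y commutes with itself, [T,T] lies in N^p. So \<open>N\<close> together with any one
  element of \<open>G\<close> sits inside a powerful group, where the results on orders apply
  although \<open>G\<close> itself need not be powerful.\<close>

lemma powerful_insert:
  assumes pe: "powerfully_embedded_in G p N" and y: "y \<in> carrier G"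
  defines "T \<equiv> generate G (insert y N)"
  shows "subgroup T G" "y \<in> T" "N \<subseteq> T" "finite_odd_p_group (G\<lparr>carrier := T\<rparr>) p"
    "powerfully_embedded_in (G\<lparr>carrier := T\<rparr>) p (carrier (G\<lparr>carrier := T\<rparr>))"
proof -
  have N: "N \<lhd> G" and c: "\<And>n g. n \<in> N \<Longrightarrow> g \<in> carrier G \<Longrightarrow> cmt n g \<in> power_gen G p N"
    using pe by (auto simp: powerfully_embedded_in_def)
  have Ns: "subgroup N G" using N by (rule normal_imp_subgroup)
  have S: "insert y N \<subseteq> carrier G" using y subgroup.subset[OF Ns] by simp
  show T: "subgroup T G" unfolding T_def using S by (rule generate_is_subgroup)
  show "y \<in> T" unfolding T_def by (intro generate.incl) simp
  show NT: "N \<subseteq> T" unfolding T_def by (auto intro: generate.incl)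
  show "finite_odd_p_group (G\<lparr>carrier := T\<rparr>) p" using T by (rule subgroup_finite_odd_p_group)
  have P: "power_gen G p N \<lhd> G" using N by (rule power_gen_normal)
  have gens: "cmt s s' \<in> power_gen G p N" if s: "s \<in> insert y N" "s' \<in> insert y N" for s s'
  proof -
    have G: "s \<in> carrier G" "s' \<in> carrier G" using s S by auto
    consider "s \<in> N" | "s' \<in> N" | "s = y \<and> s' = y" using s by auto
    then show ?thesis
    proof cases
      case 1
      then show ?thesis using c G by simp
    next
      case 2
      then show ?thesis using commutator_swap_mem[OF normal_imp_subgroup[OF P] G(2,1)] c G by simp
    next
      case 3
      then show ?thesis using G subgroup.one_closed[OF normal_imp_subgroup[OF P]] by (simp add: word_simps)
    qed
  qed
  have "cmt a b \<in> power_gen G p N" if "a \<in> T" "b \<in> T" for a b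
    by (rule commutator_generate_mem[OF P S S]) (use gens that T_def in auto)
  moreover have "power_gen G p N \<subseteq> power_gen G p T"
    unfolding power_gen_def using NT by (intro mono_generate) auto
  ultimately show "powerfully_embedded_in (G\<lparr>carrier := T\<rparr>) p (carrier (G\<lparr>carrier := T\<rparr>))"
    using powerfully_embedded_in_subgroup[OF T, of p] by (simp add: subset_iff)
qed

lemma powerful_insert_order_mult:
  assumes pe: "powerfully_embedded_in G p N" and y: "y \<in> carrier G"
    and "a \<in> generate G (insert y N)" "b \<in> generate G (insert y N)"
    and "a [^] (p ^ i) = \<one>" "b [^] (p ^ i) = \<one>"
  shows "(a \<otimes> b) [^] (p ^ i) = \<one>"
  using powerful_order_mult_commutator[OF powerful_insert(4,5)[OF pe y]] assms(3-)
  by (simp add: nat_pow_consistent[symmetric])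

lemma powerfully_embedded_commutator_order:
  assumes pe: "powerfully_embedded_in G p N" and y: "y \<in> carrier G"
    and n: "n \<in> N" and o: "n [^] (p ^ Suc i) = \<one>" "y [^] (p ^ i) = \<one>" and "j \<le> i"
  shows "cmt (n [^] (p ^ j)) y [^] (p ^ (i - j)) = \<one>"
proof -
  define T where "T = generate G (insert y N)"
  note T = powerful_insert[OF pe y, folded T_def]
  have nT: "n \<in> T" using T(3) n by auto
  have "commutator (G\<lparr>carrier := T\<rparr>) (n [^] (p ^ j)) y [^] (p ^ (i - j)) = \<one>"
    using powerful_order_mult_commutator[OF T(4,5)] nT T(2) o \<open>j \<le> i\<close>
    by (simp add: nat_pow_consistent[symmetric] del: power_Suc)
  then show ?thesis
    using commutator_consistent[OF T(1) subgroup_pow_closed[OF T(1) nT] T(2)] by simp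
qed

text \<open>[n,y] is a conjugate of y^(-1) times y, a product of two elements of bounded order in
  the powerful group <y, N>.\<close>

lemma powerfully_embedded_commutator_order_self:
  assumes pe: "powerfully_embedded_in G p N" and y: "y \<in> carrier G"
    and n: "n \<in> N" and o: "y [^] (p ^ i) = \<one>"
  shows "cmt n y [^] (p ^ i) = \<one>"
proof -
  define T where "T = generate G (insert y N)"
  note T = powerful_insert[OF pe y, folded T_def]
  have nT: "n \<in> T" using T(3) n by auto
  have nG: "n \<in> carrier G" using subgroup.mem_carrier[OF T(1) nT] .
  have "inv n \<otimes> inv y \<otimes> n \<in> T"
    using T(1,2) nT by (simp add: subgroup.m_closed subgroup.m_inv_closed)
  moreover have "(inv n \<otimes> inv y \<otimes> n) [^] (p ^ i) = \<one>"
    using nG y o by (simp add: conj_pow nat_pow_inv)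
  ultimately show ?thesis
    using powerful_insert_order_mult[OF pe y, folded T_def] T(2) o by (simp add: commutator_def)
qed

lemma power_series_bounded_order_normal:
  assumes pe: "powerfully_embedded_in G p N"
  shows "{x \<in> power_series G p N m. x [^] (p ^ t) = \<one>} \<lhd> G"
proof (rule normal_subgroup_of_bounded_order[OF power_series_normal[OF pe]])
  fix x y assume "x \<in> power_series G p N m" "y \<in> power_series G p N m"
    "x [^] (p ^ t) = \<one>" "y [^] (p ^ t) = \<one>"
  moreover have "power_series G p N m \<subseteq> generate G (insert \<one> N)"
    using power_series_antimono[OF pe, of 0 m] powerful_insert(3)[OF pe one_closed] by simp
  ultimately show "(x \<otimes> y) [^] (p ^ t) = \<one>"
    by (intro powerful_insert_order_mult[OF pe one_closed]) auto
qed

text \<open>Each commutator with a generator from \<open>X\<close> moves one term down the power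
  series of \<open>N\<close> and loses one factor p of the order. Both facts have to be carried
  together, since the first provides the root needed for the second.\<close>

lemma lower_central_order:
  assumes pe: "powerfully_embedded_in G p N"
    and X: "X \<subseteq> {x \<in> carrier G. x [^] (p ^ i) = \<one>}" and H: "H = generate G X" "H \<lhd> G"
    and LN: "lower_central G H r \<subseteq> N"
    and z: "z \<in> lower_central G H (r + Suc s)"
  shows "z [^] (p ^ (i - s)) = \<one>"
proof -
  define E where "E = (\<lambda>s. {x \<in> power_series G p N (Suc s). x [^] (p ^ (i - s)) = \<one>})"
  have E: "E s \<lhd> G" for s unfolding E_def by (rule power_series_bounded_order_normal[OF pe])
  have XG: "X \<subseteq> carrier G" using X by auto
  have Ns: "subgroup N G" using pe normal_imp_subgroup by (auto simp: powerfully_embedded_in_def)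
  have gen: "commutator_gen G A H \<subseteq> E s"
    if A: "A \<subseteq> carrier G" and AX: "\<And>a x. a \<in> A \<Longrightarrow> x \<in> X \<Longrightarrow> cmt a x \<in> E s" for A s
  proof -
    have "cmt a h \<in> E s" if "a \<in> A" "h \<in> H" for a h
      by (rule commutator_generate_mem[OF E A XG]) (use that AX H in \<open>auto intro: generate.incl\<close>)
    then show ?thesis
      unfolding commutator_gen_def
      by (intro generate_subgroup_incl normal_imp_subgroup[OF E]) auto
  qed
  have "lower_central G H (r + Suc s) \<subseteq> E s"
  proof (induction s)
    case 0
    have "cmt a x \<in> E 0" if a: "a \<in> N" and x: "x \<in> X" for a x
    proof -
      have xG: "x \<in> carrier G" and ox: "x [^] (p ^ i) = \<one>" using X x by auto
      have "cmt a x \<in> power_series G p N (Suc 0)"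
        using power_series_commutator[OF pe, of a 0 x] a xG by simp
      then show ?thesis
        using powerfully_embedded_commutator_order_self[OF pe xG a ox] by (simp add: E_def)
    qed
    then have "commutator_gen G (lower_central G H r) H \<subseteq> E 0"
      using LN subgroup.subset[OF Ns] by (intro gen) auto
    then show ?case by simp
  next
    case (Suc s)
    have "cmt a x \<in> E (Suc s)" if a: "a \<in> E s" and x: "x \<in> X" for a x
    proof -
      have xG: "x \<in> carrier G" and ox: "x [^] (p ^ i) = \<one>" using X x by auto
      have aP: "a \<in> power_series G p N (Suc s)" and oa: "a [^] (p ^ (i - s)) = \<one>"
        using a by (auto simp: E_def)
      have aG: "a \<in> carrier G"
        using aP normal_imp_subgroup[OF power_series_normal[OF pe]] subgroup.mem_carrier by metis
      have 1: "cmt a x \<in> power_series G p N (Suc (Suc s))"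
        using power_series_commutator[OF pe aP xG] .
      have 2: "cmt a x [^] (p ^ (i - Suc s)) = \<one>"
      proof (cases "s < i")
        case True
        \<comment> \<open>a is a p^(s+1)-th power and a^(p^(i-s)) = 1, so the root n is killed by
          p^(i+1), the order allowed in \<open>powerfully_embedded_commutator_order\<close>.\<close>
        obtain n where n: "n \<in> N" "n [^] (p ^ Suc s) = a"
          using mem_power_series_imp_power[OF pe aP] by auto
        have nG: "n \<in> carrier G" using subgroup.mem_carrier[OF Ns n(1)] .
        have "Suc i = Suc s + (i - s)" using True by simp
        then have "n [^] (p ^ Suc i) = \<one>"
          using pow_prime_power_pow[OF nG, of "Suc s" "i - s"] n(2) oa by metis
        from powerfully_embedded_commutator_order[OF pe xG n(1) this ox, of "Suc s"] True n(2)
        show ?thesis by simp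
      next
        \<comment> \<open>Here the truncated difference \<open>i - s\<close> is 0, so
          \<open>a\<close> is already trivial.\<close>
        case False
        then have "a = \<one>" using oa aG by simp
        then show ?thesis using xG by (simp add: word_simps)
      qed
      show ?thesis using 1 2 by (simp add: E_def)
    qed
    then have "commutator_gen G (lower_central G H (r + Suc s)) H \<subseteq> E (Suc s)"
      using Suc.IH normal_imp_subgroup[OF lower_central_normal[OF H(2)]] subgroup.subset
      by (intro gen) blast+
    then show ?case by simp
  qed
  then show ?thesis using z by (auto simp: E_def)
qed

end

section \<open>Exponents of the lower central terms\<close>

text \<open>Take v to be the p-adic valuation of s. Then p^m divides s (p^m choose s), and s
  contributes only p^v.\<close>

lemma prime_power_dvd_choose:
  fixes p :: nat
  assumes p: "prime p" and s: "0 < s" "s \<le> p ^ m"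
  shows "\<exists>v\<le>m. p ^ v \<le> s \<and> p ^ (m - v) dvd (p ^ m choose s)"
proof -
  have "s \<noteq> 0" "\<not> is_unit p" using s p by auto
  then obtain t where t: "s = p ^ multiplicity p s * t" "\<not> p dvd t"
    by (rule multiplicity_decompose')
  define v where "v = multiplicity p s"
  have le: "p ^ v \<le> s" using s(1) by (simp add: v_def multiplicity_dvd dvd_imp_le)
  then have "p ^ v \<le> p ^ m" using s(2) by simp
  then have vm: "v \<le> m" using prime_gt_1_nat[OF p] by simp
  have "s * (p ^ m choose s) = p ^ m * ((p ^ m - 1) choose (s - 1))"
    using s(1) by (rule times_binomial_minus1_eq)
  then have "p ^ m dvd s * (p ^ m choose s)" by simp
  then have "p ^ v * p ^ (m - v) dvd p ^ v * (t * (p ^ m choose s))"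
    using vm t(1) by (simp add: v_def[symmetric] power_add[symmetric] mult.assoc)
  then have "p ^ (m - v) dvd t * (p ^ m choose s)"
    using prime_gt_0_nat[OF p] by simp
  moreover have "coprime (p ^ (m - v)) t"
    using p t(2) by (simp add: prime_imp_coprime coprime_power_left_iff)
  ultimately have "p ^ (m - v) dvd (p ^ m choose s)"
    by (simp add: coprime_dvd_mult_right_iff)
  then show ?thesis using vm le by auto
qed

text \<open>Bernoulli's inequality. It converts a lost exponent v into at least (p-1) v further
  steps of the lower central series.\<close>

lemma linear_le_power: "(p - 1) * v + 1 \<le> p ^ v" if "0 < p" for p v :: nat
proof (induction v)
  case (Suc v)
  have "1 \<le> p ^ v" using that by simp
  then have "(p - 1) * 1 \<le> (p - 1) * p ^ v" by (intro mult_le_mono2)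
  moreover have "p ^ Suc v = p ^ v + (p - 1) * p ^ v"
    using that by (cases p) simp_all
  ultimately show ?case using Suc unfolding mult_Suc_right by linarith
qed simp

context finite_odd_p_group
begin

text \<open>Since x commutes with itself, <x, L_q> has its commutators in L_{q+1}, where L_r denotes
  \<open>lower_central G H r\<close>. So degrees 0 and 1 can both be this subgroup and degree s >= 2
  can be L_{q+s-1}.\<close>

lemma lower_central_filtration:
  assumes H: "H \<lhd> G" and x: "x \<in> H"
  shows "commutator_filtration G
    (\<lambda>s. if s \<le> 1 then generate G (insert x (lower_central G H q)) else lower_central G H (q + s - 1))"
proof -
  let ?L = "lower_central G H"
  define M where "M = generate G (insert x (?L q))"
  define K where "K = (\<lambda>s. if s \<le> 1 then M else ?L (q + s - 1))"
  have Ln: "?L r \<lhd> G" for r using H by (rule lower_central_normal)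
  have Ls: "subgroup (?L r) G" for r using Ln by (rule normal_imp_subgroup)
  have Hs: "subgroup H G" using H by (rule normal_imp_subgroup)
  have LH: "?L r \<subseteq> H" for r using lower_central_antimono[OF H, of 0 r] by simp
  have S: "insert x (?L q) \<subseteq> carrier G"
    using subgroup.subset[OF Ls] subgroup.mem_carrier[OF Hs x] by simp
  have Ms: "subgroup M G" unfolding M_def using S by (rule generate_is_subgroup)
  have MH: "M \<subseteq> H" unfolding M_def using LH x Hs by (intro generate_subgroup_incl) auto
  have LM: "?L q \<subseteq> M" unfolding M_def by (auto intro: generate.incl)
  have LHc: "cmt a b \<in> ?L (Suc r)" "cmt b a \<in> ?L (Suc r)" if "a \<in> ?L r" "b \<in> H" for a b r
  proof -
    show 1: "cmt a b \<in> ?L (Suc r)" using that by (simp add: commutator_mem_commutator_gen)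
    show "cmt b a \<in> ?L (Suc r)"
      using commutator_swap_mem[OF Ls _ _ 1] subgroup.mem_carrier[OF Ls that(1)]
        subgroup.mem_carrier[OF Hs that(2)] by simp
  qed
  have gens: "cmt s s' \<in> ?L (Suc q)" if s: "s \<in> insert x (?L q)" "s' \<in> insert x (?L q)" for s s'
  proof -
    consider "s \<in> ?L q" | "s' \<in> ?L q" | "s = x \<and> s' = x" using s by auto
    then show ?thesis
    proof cases
      case 1
      then show ?thesis using LHc(1) s(2) x LH by blast
    next
      case 2
      then show ?thesis using LHc(2) s(1) x LH by blast
    next
      case 3
      then show ?thesis using S subgroup.one_closed[OF Ls, of "Suc q"]
        by (simp add: word_simps del: lower_central.simps)
    qed
  qed
  have MM: "cmt a b \<in> ?L (Suc q)" if "a \<in> M" "b \<in> M" for a b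
    by (rule commutator_generate_mem[OF Ln S S]) (use gens that M_def in \<open>auto simp del: lower_central.simps\<close>)
  have anti: "?L r \<subseteq> ?L r'" if "r' \<le> r" for r r' using H that by (rule lower_central_antimono)
  have "commutator_filtration G K"
  proof (intro commutator_filtration.intro commutator_filtration_axioms.intro)
    show "group G" by (rule is_group)
    show "subgroup (K i) G" for i using Ms Ls by (simp add: K_def)
    show "K (Suc i) \<subseteq> K i" for i
    proof -
      consider "i = 0" | "i = 1" | "2 \<le> i" by linarith
      then show ?thesis
        using anti[of q "Suc q"] anti[of "q + i - 1" "q + i"] LM by cases (auto simp: K_def)
    qed
    show "cmt a b \<in> K (i + j)" if a: "a \<in> K i" and b: "b \<in> K j" for a b i j
    proof -
      have KH: "K i \<subseteq> H" for i using MH LH by (simp add: K_def)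
      have aH: "a \<in> H" and bH: "b \<in> H" using a b KH by blast+
      consider "i \<le> 1" "j \<le> 1" | "i \<le> 1" "2 \<le> j" | "2 \<le> i" "j \<le> 1" | "2 \<le> i" "2 \<le> j" by linarith
      then show ?thesis
      proof cases
        case 1
        then have "cmt a b \<in> ?L (Suc q)" using a b MM by (simp add: K_def)
        moreover have "?L (Suc q) \<subseteq> K (i + j)"
          using 1 anti[of "i + j + q - 1" "Suc q"] anti[of q "Suc q"] LM
          by (cases "i + j \<le> 1") (auto simp: K_def add.commute simp del: lower_central.simps)
        ultimately show ?thesis by blast
      next
        case 2
        then have "cmt a b \<in> ?L (Suc (q + j - 1))"
          using LHc(2)[of b "q + j - 1" a] a b aH by (simp add: K_def)
        moreover have "?L (Suc (q + j - 1)) \<subseteq> ?L (i + j + q - 1)"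
          by (rule anti) (use 2 in linarith)
        ultimately show ?thesis
          using 2 by (auto simp: K_def add.commute simp del: lower_central.simps)
      next
        case 3
        then have "cmt a b \<in> ?L (Suc (q + i - 1))"
          using LHc(1)[of a "q + i - 1" b] a b bH by (simp add: K_def)
        moreover have "?L (Suc (q + i - 1)) \<subseteq> ?L (i + j + q - 1)"
          by (rule anti) (use 3 in linarith)
        ultimately show ?thesis
          using 3 by (auto simp: K_def add.commute simp del: lower_central.simps)
      next
        case 4
        then have "cmt a b \<in> ?L (Suc ((q + i - 1) + (q + j - 1)))"
          using lower_central_commutator[OF H, of a "q + i - 1" b "q + j - 1"] a b by (simp add: K_def)
        moreover have "?L (Suc ((q + i - 1) + (q + j - 1))) \<subseteq> ?L (i + j + q - 1)"
          by (rule anti) (use 4 in linarith)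
        ultimately show ?thesis
          using 4
          by (auto simp: K_def add.commute simp del: lower_central.simps)
      qed
    qed
  qed
  then show ?thesis unfolding K_def M_def .
qed

lemma lower_central_exponent:
  assumes X: "X \<subseteq> {x \<in> carrier G. x [^] (p ^ i) = \<one>}" and H: "H = generate G X" "H \<lhd> G"
    and base: "\<And>s z. z \<in> lower_central G H (k + s) \<Longrightarrow> z [^] (p ^ (i - s)) = \<one>"
    and qm: "k + (p - 1) * i \<le> q + (p - 1) * m"
    and z: "z \<in> lower_central G H q"
  shows "z [^] (p ^ m) = \<one>"
  using qm z
proof (induction "k - q" arbitrary: q m z rule: less_induct)
  case (less q m z)
  let ?L = "lower_central G H"
  have p2: "2 \<le> p - 1"
  proof -
    have "p \<noteq> 2" using odd by auto
    then show ?thesis using prime_ge_2_nat[OF prime] by simp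
  qed
  have Ln: "?L r \<lhd> G" for r using H(2) by (rule lower_central_normal)
  have Ls: "subgroup (?L r) G" for r using Ln by (rule normal_imp_subgroup)
  have zG: "z \<in> carrier G" using subgroup.mem_carrier[OF Ls less.prems(2)] .
  show ?case
  proof (cases "k \<le> q")
    case True
    then obtain s where s: "q = k + s" using le_Suc_ex by blast
    have "i - s \<le> m"
    proof (rule ccontr)
      assume "\<not> i - s \<le> m"
      then have "m + s < i" by simp
      then have le: "(p - 1) * (m + Suc s) \<le> (p - 1) * i" by (intro mult_le_mono2) simp
      have "1 * Suc s \<le> (p - 1) * Suc s" using p2 by (intro mult_le_mono1) simp
      then have "(p - 1) * m + Suc s \<le> (p - 1) * m + (p - 1) * Suc s" by simp
      also have "\<dots> = (p - 1) * (m + Suc s)" by (rule distrib_left[symmetric])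
      also note le
      finally show False using less.prems(1) s by linarith
    qed
    then have "z [^] (p ^ m) = (z [^] (p ^ (i - s))) [^] (p ^ (m - (i - s)))"
      using pow_prime_power_pow[OF zG, of "i - s" "m - (i - s)"] by simp
    then show ?thesis using base less.prems(2) s by simp
  next
    case False
    \<comment> \<open>Below \<open>k\<close> the inequality forces i <= m, so the generators in
      \<open>X\<close> are killed by p^m.\<close>
    have im: "i \<le> m"
    proof (rule ccontr)
      assume "\<not> i \<le> m"
      then have "(p - 1) * m \<le> (p - 1) * i" by (intro mult_le_mono2) simp
      then show False using less.prems(1) False by linarith
    qed
    \<comment> \<open>As s >= 2, the term at q+s-1 is strictly further down and the induction
      hypothesis applies with m-v in place of m: the loss (p-1) v is at most s-1.\<close>
    have vanish: "w [^] (p ^ m choose s) = \<one>"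
      if s: "2 \<le> s" "s \<le> p ^ m" and w: "w \<in> ?L (q + s - 1)" for s w
    proof -
      obtain v where v: "v \<le> m" "p ^ v \<le> s" "p ^ (m - v) dvd (p ^ m choose s)"
        using prime_power_dvd_choose[OF prime, of s m] s by auto
      have wG: "w \<in> carrier G" using subgroup.mem_carrier[OF Ls w] .
      have "(p - 1) * m = (p - 1) * (m - v) + (p - 1) * v"
        using v(1) by (simp flip: distrib_left)
      moreover have "(p - 1) * v + 1 \<le> s"
        using linear_le_power[of p v] prime_gt_0_nat[OF prime] v(2) by simp
      ultimately have "k + (p - 1) * i \<le> q + s - 1 + (p - 1) * (m - v)"
        using less.prems(1) s(1) by linarith
      then have "w [^] (p ^ (m - v)) = \<one>"
        using False s(1) w by (intro less.hyps[of "q + s - 1"]) auto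
      moreover obtain c where "(p ^ m choose s) = p ^ (m - v) * c" using v(3) by (rule dvdE)
      ultimately show ?thesis using nat_pow_pow[OF wG, of "p ^ (m - v)" c] by simp
    qed
    \<comment> \<open>All Hall-Petrescu corrections vanish by \<open>vanish\<close>. Taking x = 1
      shows that the elements of the term killed by p^m form a subgroup; taking x in
      \<open>X\<close> handles the generating commutators.\<close>
    have hom: "(a \<otimes> b) [^] (p ^ m) = a [^] (p ^ m) \<otimes> b [^] (p ^ m)"
      if x: "x \<in> H" and ab: "a \<in> generate G (insert x (?L q))" "b \<in> generate G (insert x (?L q))" for x a b
    proof -
      interpret K: commutator_filtration G
        "\<lambda>s. if s \<le> 1 then generate G (insert x (?L q)) else ?L (q + s - 1)"
        using H(2) x by (rule lower_central_filtration)
      show ?thesis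
        by (rule K.hall_petrescu_trivial) (use ab vanish in auto)
    qed
    have one: "\<one> \<in> H" using subgroup.one_closed[OF normal_imp_subgroup[OF H(2)]] .
    define S where "S = {z \<in> ?L q. z [^] (p ^ m) = \<one>}"
    have S: "S \<lhd> G" unfolding S_def
    proof (rule normal_subgroup_of_bounded_order[OF Ln])
      show "(a \<otimes> b) [^] (p ^ m) = \<one>"
        if "a \<in> ?L q" "b \<in> ?L q" "a [^] (p ^ m) = \<one>" "b [^] (p ^ m) = \<one>" for a b
        using hom[OF one, of a b] that by (simp add: generate.incl)
    qed
    have oX: "x [^] (p ^ m) = \<one>" if "x \<in> X" for x
      using X that im pow_prime_power_pow[of x i "m - i"] by auto
    have XG: "X \<subseteq> carrier G" using X by auto
    have XH: "X \<subseteq> H" using H(1) by (auto intro: generate.incl)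
    have "?L q \<subseteq> S"
    proof (cases q)
      case 0
      have "X \<subseteq> S" using oX XH by (auto simp: S_def 0)
      then have "generate G X \<subseteq> S" using normal_imp_subgroup[OF S] by (rule generate_subgroup_incl)
      then show ?thesis using H(1) 0 by simp
    next
      case (Suc q')
      have gens: "cmt c x \<in> S" if c: "c \<in> ?L q'" and x: "x \<in> X" for c x
      proof -
        have G: "c \<in> carrier G" "x \<in> carrier G"
          using c x XG subgroup.mem_carrier[OF Ls] by auto
        have "cmt c x \<in> ?L q" using c x XH Suc by (auto intro: commutator_mem_commutator_gen)
        then have xc: "cmt x c \<in> ?L q" using commutator_swap_mem[OF Ls G] by simp
        \<comment> \<open>The product is the conjugate of x by c, hence is killed by p^m just like
          x; so [x,c] is killed as well.\<close>
        have "(x \<otimes> cmt x c) [^] (p ^ m) = x [^] (p ^ m) \<otimes> cmt x c [^] (p ^ m)"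
          by (rule hom[of x]) (use xc x XH in \<open>auto intro: generate.incl\<close>)
        moreover have "(x \<otimes> cmt x c) [^] (p ^ m) = \<one>"
          using conj_pow[OF G(2,1), of "p ^ m"] oX[OF x] G by (simp add: conj_eq_mult_commutator)
        ultimately have "cmt x c \<in> S" using oX[OF x] G xc by (simp add: S_def)
        then show ?thesis using commutator_swap_mem[OF normal_imp_subgroup[OF S] G(2,1)] by simp
      qed
      have "cmt c h \<in> S" if "c \<in> ?L q'" "h \<in> H" for c h
        by (rule commutator_generate_mem[OF S subgroup.subset[OF Ls[of q']] XG])
          (use gens that H(1) in \<open>auto intro: generate.incl\<close>)
      then show ?thesis
        unfolding Suc lower_central.simps commutator_gen_def
        by (intro generate_subgroup_incl normal_imp_subgroup[OF S]) auto
    qed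
    then show ?thesis using less.prems(2) by (auto simp: S_def)
  qed
qed

text \<open>The hypothesis on commutators is what an eta-series leaves behind in a finite quotient,
  stated without quotients by the \<open>N j\<close>.\<close>

lemma finite_Omega_power_eq_one:
  assumes N0: "N 0 = {\<one>}" and Nk: "N k = carrier G" and Nn: "\<And>j. N j \<lhd> G"
    and Nc: "\<And>j x g. x \<in> N (Suc j) \<Longrightarrow> g \<in> carrier G \<Longrightarrow> cmt x g \<in> N j <#> power_gen G p (N (Suc j))"
    and kl: "k \<le> l * (p - 1)"
    and z: "z \<in> generate G {x \<in> carrier G. x [^] (p ^ i) = \<one>}"
  shows "z [^] (p ^ (i + l)) = \<one>"
proof (cases k)
  case 0
  then have "carrier G = {\<one>}" using N0 Nk by simp
  moreover have "z \<in> carrier G" using z generate_in_carrier[of "{x \<in> carrier G. x [^] (p ^ i) = \<one>}" z] by auto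
  ultimately show ?thesis by simp
next
  case (Suc k')
  \<comment> \<open>The numbering is reversed: \<open>F d\<close> is the term with subscript k-d in
    the overview, so the recursion starts from the whole group.\<close>
  define F where "F = rec_nat (carrier G) (\<lambda>d A. generate G (N (k - Suc d) \<union> {a [^] p | a. a \<in> A}))"
  have F0: "F 0 = carrier G" and FS: "F (Suc d) = generate G (N (k - Suc d) \<union> {a [^] p | a. a \<in> F d})" for d
    by (simp_all add: F_def)
  have NG: "N j \<subseteq> carrier G" for j using normal_imp_subgroup[OF Nn] by (rule subgroup.subset)
  have Fn: "F d \<lhd> G" for d
  proof (induction d)
    case 0
    then show ?case unfolding F0 normal_inv_iff using subgroup_self by simp
  next
    case (Suc d)
    interpret A: normal "F d" G by fact
    show ?case unfolding FS
    proof (rule normal_generateI)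
      show "N (k - Suc d) \<union> {a [^] p | a. a \<in> F d} \<subseteq> carrier G" using NG A.subset by auto
      fix h g assume h: "h \<in> N (k - Suc d) \<union> {a [^] p | a. a \<in> F d}" and g: "g \<in> carrier G"
      show "g \<otimes> h \<otimes> inv g \<in> N (k - Suc d) \<union> {a [^] p | a. a \<in> F d}"
      proof (cases "h \<in> N (k - Suc d)")
        case True
        then show ?thesis using normal.inv_op_closed2[OF Nn g] by auto
      next
        case False
        then obtain a where a: "a \<in> F d" "h = a [^] p" using h by auto
        have "g \<otimes> h \<otimes> inv g = (g \<otimes> a \<otimes> inv g) [^] p"
          using conj_pow[of a "inv g" p] a g by simp
        then show ?thesis using A.inv_op_closed2[OF g a(1)] by auto
      qed
    qed
  qed
  have Fs: "subgroup (F d) G" for d using Fn by (rule normal_imp_subgroup)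
  have NF: "N (k - Suc d) \<subseteq> F (Suc d)" for d unfolding FS by (auto intro: generate.incl)
  have PF: "power_gen G p A \<subseteq> F (Suc d)" if "A \<subseteq> F d" for A d
    unfolding FS power_gen_def using that by (intro mono_generate) auto
  have NPF: "x \<in> F (Suc d)" if "x \<in> N (k - Suc d) <#> power_gen G p A" "A \<subseteq> F d" for x A d
    using that(1) NF[of d] PF[OF that(2)] subgroup.m_closed[OF Fs] unfolding set_mult_def by blast
  have Fc: "cmt x g \<in> F (Suc d)" if "d < k" "x \<in> F d" "g \<in> carrier G" for d x g
    using that
  proof (induction d arbitrary: x g)
    case 0
    then show ?case using Nc[of x k' g] Nk Suc F0 NPF[of "cmt x g" 0 "N k"] NG by simp
  next
    case (Suc d)
    have CW: "cmt c g \<in> F (Suc (Suc d))" if "c \<in> N (k - Suc d)" "g \<in> carrier G" for c g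
    proof -
      have e: "Suc (k - Suc (Suc d)) = k - Suc d" using Suc.prems(1) by simp
      show ?thesis
        using Nc[of c "k - Suc (Suc d)" g, unfolded e, OF that] NF[of d] by (rule NPF)
    qed
    have BW: "b [^] p \<in> F (Suc (Suc d))" if "b \<in> F (Suc d)" for b
      unfolding FS[of "Suc d"] using that by (intro generate.incl) blast
    show ?case
      by (rule commutator_generate_power_mem[OF Fn[of d] Fn[of "Suc d"] Fn[of "Suc (Suc d)"] NG _ FS CW BW])
        (use Suc in auto)
  qed
  define M where "M = F k'"
  \<comment> \<open>At the last step \<open>N 0\<close> is trivial, so \<open>F k\<close> is just
    M^p. Centrality of the series, [M,G] <= F k, thereby turns into powerful embedding of
    \<open>M\<close>.\<close>
  have "F k \<subseteq> power_gen G p M"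
    unfolding Suc FS M_def[symmetric]
  proof (rule generate_subgroup_incl)
    have sub: "subgroup (power_gen G p M) G"
      using power_gen_normal[OF Fn[of k'], of p] unfolding M_def by (rule normal_imp_subgroup)
    then show "N (Suc k' - Suc k') \<union> {a [^] p | a. a \<in> M} \<subseteq> power_gen G p M"
      using N0 subgroup.one_closed[OF sub] pow_mem_power_gen[of _ M p] by auto
    show "subgroup (power_gen G p M) G" by (rule sub)
  qed
  then have pe: "powerfully_embedded_in G p M"
    using Fn[of k'] Fc[of k'] Suc by (auto simp: powerfully_embedded_in_def M_def)
  define X where "X = {x \<in> carrier G. x [^] (p ^ i) = \<one>}"
  define H where "H = generate G X"
  have H: "H \<lhd> G" unfolding H_def
  proof (rule normal_generateI)
    show "X \<subseteq> carrier G" by (auto simp: X_def)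
    fix h g assume "h \<in> X" "g \<in> carrier G"
    then show "g \<otimes> h \<otimes> inv g \<in> X" using conj_pow[of h "inv g" "p ^ i"] by (simp add: X_def)
  qed
  have Hs: "subgroup H G" using H by (rule normal_imp_subgroup)
  have LF: "lower_central G H d \<subseteq> F d" if "d < k" for d
    using that
  proof (induction d)
    case 0
    then show ?case using subgroup.subset[OF Hs] by (simp add: F0)
  next
    case (Suc d)
    then have "{cmt x y | x y. x \<in> lower_central G H d \<and> y \<in> H} \<subseteq> F (Suc d)"
      using Fc[of d] subgroup.mem_carrier[OF Hs] by auto
    then show ?case using generate_subgroup_incl[OF _ Fs] by (simp add: commutator_gen_def)
  qed
  have base: "w [^] (p ^ (i - s)) = \<one>" if "w \<in> lower_central G H (k + s)" for s w
    using lower_central_order[OF pe _ H_def H, of i k' w s] LF[of k'] that Suc by (simp add: M_def X_def)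
  \<comment> \<open>The start of the lower central series, index 0, with m = i+l: the required
    inequality is exactly k <= l (p-1).\<close>
  have bound: "k + (p - 1) * i \<le> 0 + (p - 1) * (i + l)"
    using kl unfolding add_mult_distrib2 by (simp add: mult.commute)
  show ?thesis
    by (rule lower_central_exponent[OF _ H_def H base bound])
      (use z in \<open>auto simp: X_def H_def\<close>)
qed

end

subsection \<open>Profinite groups\<close>

context topological_group
begin

lemma continuous_map_mult:
  assumes "continuous_map X T f" "continuous_map X T g"
  shows "continuous_map X T (\<lambda>x. f x \<otimes> g x)"
proof -
  have "continuous_map X (prod_topology T T) (\<lambda>x. (f x, g x))"
    using assms by (simp add: continuous_map_pairedI)
  from continuous_map_compose[OF this continuous_mult] show ?thesis
    by (simp add: o_def)
qed

lemma openin_left_translate: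
  assumes U: "openin T U" and g: "g \<in> carrier G"
  shows "openin T {x \<in> carrier G. inv g \<otimes> x \<in> U}"
proof -
  have "continuous_map T T (\<lambda>x. inv g \<otimes> x)"
    using g by (intro continuous_map_mult) (simp_all add: topspace_eq)
  from openin_continuous_map_preimage[OF this U] show ?thesis
    by (simp add: topspace_eq)
qed

lemma openin_subgroup:
  assumes U: "subgroup U G" and V: "openin T V" "\<one> \<in> V" "V \<subseteq> U"
  shows "openin T U"
proof (subst openin_subopen, intro ballI)
  fix u assume u: "u \<in> U"
  have uG: "u \<in> carrier G" using U u by (rule subgroup.mem_carrier)
  have "x \<in> U" if "x \<in> carrier G" "inv u \<otimes> x \<in> V" for x
  proof -
    have "x = u \<otimes> (inv u \<otimes> x)" using uG that(1) by (simp add: inv_mult_cancel_left)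
    then show ?thesis using subgroup.m_closed[OF U u, of "inv u \<otimes> x"] V(3) that(2) by auto
  qed
  moreover have "u \<in> {x \<in> carrier G. inv u \<otimes> x \<in> V}" using uG V(2) by simp
  ultimately show "\<exists>W. openin T W \<and> u \<in> W \<and> W \<subseteq> U"
    using openin_left_translate[OF V(1) uG] by blast
qed

lemma closure_of_coset_meets:
  assumes c: "c \<in> T closure_of S" and U: "openin T U" "\<one> \<in> U"
  shows "\<exists>s\<in>S. s \<in> carrier G \<and> inv c \<otimes> s \<in> U"
proof -
  have cG: "c \<in> carrier G" using c by (auto simp: in_closure_of topspace_eq)
  have "c \<in> {x \<in> carrier G. inv c \<otimes> x \<in> U}" using cG U(2) by simp
  then have "\<exists>s. s \<in> S \<and> s \<in> {x \<in> carrier G. inv c \<otimes> x \<in> U}"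
    using openin_left_translate[OF U(1) cG]
    by (rule c[unfolded in_closure_of, THEN conjunct2, rule_format, OF conjI])
  then show ?thesis by auto
qed

lemma topspace_quotient_group_topology:
  "topspace (quotient_group_topology G T N) = carrier (G Mod N)"
  using quotient_imp_surjective_map[OF quotient_map_quotient_group_topology, of N]
  by (simp add: topspace_eq carrier_FactGroup)

end

context profinite_group
begin

text \<open>In a compact Hausdorff space quasi-components are components, and here components are
  single points.\<close>

lemma clopen_separation:
  assumes x: "x \<in> carrier G" "x \<noteq> \<one>"
  shows "\<exists>V. openin T V \<and> closedin T V \<and> \<one> \<in> V \<and> x \<notin> V"
proof (rule ccontr)
  assume "\<not> ?thesis"
  then have "quasi_component_of T \<one> x"
    using x(1) by (auto simp: quasi_component_of topspace_eq)
  then have "connected_component_of T \<one> x"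
    using quasi_eq_connected_component_of[of T \<one>] compact Hausdorff by simp
  then obtain C where "connectedin T C" "\<one> \<in> C" "x \<in> C"
    by (auto simp: connected_component_of_def)
  then show False using totally_disconnected[of C] x(2) by blast
qed

text \<open>The elements \<open>g\<close> which can be inserted into any product \<open>a b\<close> without changing its
  membership in \<open>V\<close> form the largest normal subgroup whose cosets \<open>V\<close> is a union of.\<close>

lemma open_normal_subgroup_separation:
  assumes x: "x \<in> carrier G" "x \<noteq> \<one>"
  shows "\<exists>U. U \<lhd> G \<and> openin T U \<and> x \<notin> U"
proof -
  obtain V where V: "openin T V" "closedin T V" "\<one> \<in> V" "x \<notin> V"
    using clopen_separation[OF x] by blast
  define U where "U = {g \<in> carrier G. \<forall>a\<in>carrier G. \<forall>b\<in>carrier G. a \<otimes> g \<otimes> b \<in> V \<longleftrightarrow> a \<otimes> b \<in> V}"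
  have UI: "g \<in> U"
    if "g \<in> carrier G" "\<And>a b. a \<in> carrier G \<Longrightarrow> b \<in> carrier G \<Longrightarrow> a \<otimes> g \<otimes> b \<in> V \<longleftrightarrow> a \<otimes> b \<in> V" for g
    using that by (simp add: U_def)
  have UD: "a \<otimes> g \<otimes> b \<in> V \<longleftrightarrow> a \<otimes> b \<in> V" if "g \<in> U" "a \<in> carrier G" "b \<in> carrier G" for g a b
    using that by (simp add: U_def)
  have UG: "g \<in> carrier G" if "g \<in> U" for g using that by (simp add: U_def)
  have sub: "subgroup U G"
  proof (rule subgroupI)
    show "U \<subseteq> carrier G" using UG by blast
    have "\<one> \<in> U" by (rule UI) simp_all
    then show "U \<noteq> {}" by blast
    show "inv g \<in> U" if g: "g \<in> U" for g
    proof (rule UI)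
      fix a b assume ab: "a \<in> carrier G" "b \<in> carrier G"
      have "a \<otimes> inv g \<otimes> b \<in> V \<longleftrightarrow> (a \<otimes> inv g) \<otimes> g \<otimes> b \<in> V"
        using UD[OF g, of "a \<otimes> inv g" b] ab UG[OF g] by simp
      then show "a \<otimes> inv g \<otimes> b \<in> V \<longleftrightarrow> a \<otimes> b \<in> V"
        using ab UG[OF g] by (simp add: m_assoc inv_mult_cancel_left)
    qed (use UG[OF g] in simp)
    show "g \<otimes> h \<in> U" if g: "g \<in> U" and h: "h \<in> U" for g h
    proof (rule UI)
      fix a b assume ab: "a \<in> carrier G" "b \<in> carrier G"
      have "(a \<otimes> g) \<otimes> h \<otimes> b \<in> V \<longleftrightarrow> a \<otimes> b \<in> V"
        using UD[OF h, of "a \<otimes> g" b] UD[OF g ab] ab UG[OF g] by simp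
      then show "a \<otimes> (g \<otimes> h) \<otimes> b \<in> V \<longleftrightarrow> a \<otimes> b \<in> V"
        using ab UG[OF g] UG[OF h] by (simp add: m_assoc)
    qed (use UG[OF g] UG[OF h] in simp)
  qed
  have "U \<lhd> G" unfolding normal_inv_iff
  proof (intro conjI ballI sub)
    fix y g assume y: "y \<in> carrier G" and g: "g \<in> U"
    show "y \<otimes> g \<otimes> inv y \<in> U"
    proof (rule UI)
      fix a b assume ab: "a \<in> carrier G" "b \<in> carrier G"
      have "(a \<otimes> y) \<otimes> g \<otimes> (inv y \<otimes> b) \<in> V \<longleftrightarrow> (a \<otimes> y) \<otimes> (inv y \<otimes> b) \<in> V"
        using g ab y by (intro UD) simp_all
      then show "a \<otimes> (y \<otimes> g \<otimes> inv y) \<otimes> b \<in> V \<longleftrightarrow> a \<otimes> b \<in> V"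
        using ab y UG[OF g] by (simp add: m_assoc inv_mult_cancel_left)
    qed (use y UG[OF g] in simp)
  qed
  moreover have "openin T U"
  proof -
    let ?P = "prod_topology (prod_topology T T) T"
    let ?f = "\<lambda>q. fst (fst q) \<otimes> snd q \<otimes> snd (fst q)" and ?g = "\<lambda>q. fst (fst q) \<otimes> snd (fst q)"
    let ?W = "\<lambda>V. {q \<in> topspace ?P. ?f q \<in> V} \<inter> {q \<in> topspace ?P. ?g q \<in> V}"
    have proj: "continuous_map ?P T (\<lambda>q. fst (fst q))" "continuous_map ?P T (\<lambda>q. snd (fst q))" "continuous_map ?P T snd"
      using continuous_map_compose[OF continuous_map_fst continuous_map_fst, of T T T]
        continuous_map_compose[OF continuous_map_fst continuous_map_snd, of T T T]
      by (simp_all add: o_def continuous_map_snd)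
    have f: "continuous_map ?P T ?f" and g: "continuous_map ?P T ?g"
      by (intro continuous_map_mult proj)+
    \<comment> \<open>The open set of all ((a,b),g) for which a g b and a b are both in
      \<open>V\<close> or both outside; openness uses that \<open>V\<close> is clopen.\<close>
    have W: "openin ?P (?W V \<union> ?W (carrier G - V))"
      using openin_continuous_map_preimage[OF f] openin_continuous_map_preimage[OF g]
        V(1) V(2)[unfolded closedin_def topspace_eq] by blast
    have C: "compactin (prod_topology T T) (carrier G \<times> carrier G)"
      using compact compact_space_prod_topology[of T T] by (simp add: compact_space_def topspace_eq)
    have "(carrier G \<times> carrier G) \<times> {\<one>} \<subseteq> ?W V \<union> ?W (carrier G - V)"
      by (auto simp: topspace_eq)
    \<comment> \<open>Compactness of \<open>carrier G\<close> squared gives one neighbourhood of 1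
      that works for all a and b at once, so \<open>U\<close> is open.\<close>
    from tube_lemma_left[OF W C _ this] obtain A B where AB: "openin T B" "\<one> \<in> B"
        "carrier G \<times> carrier G \<subseteq> A" "A \<times> B \<subseteq> ?W V \<union> ?W (carrier G - V)"
      by (auto simp: topspace_eq)
    have "B \<subseteq> U"
    proof
      fix g assume g: "g \<in> B"
      show "g \<in> U"
      proof (rule UI)
        show "g \<in> carrier G" using openin_subset[OF AB(1)] g by (auto simp: topspace_eq)
        fix a b assume "a \<in> carrier G" "b \<in> carrier G"
        then have "((a, b), g) \<in> ?W V \<union> ?W (carrier G - V)" using AB(3,4) g by blast
        then show "a \<otimes> g \<otimes> b \<in> V \<longleftrightarrow> a \<otimes> b \<in> V" by auto
      qed
    qed
    then show ?thesis using openin_subgroup[OF sub AB(1,2)] by blast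
  qed
  moreover have "x \<notin> U"
    using UD[of x \<one> \<one>] V(3,4) x(1) by auto
  ultimately show ?thesis by blast
qed

end

section \<open>Passage from the pro-p group to its finite quotients\<close>

context topological_group
begin

text \<open>Powerful embedding in the quotient by \<open>N j\<close> only puts the commutator in the
  closure of the subgroup generated by p-th powers. Modulo an open normal subgroup a closure point
  can be replaced by a nearby point of that subgroup, and a lift of the latter costs a factor from
  \<open>N j\<close>.\<close>

lemma eta_series_commutator_mem:
  assumes eta: "eta_series p G T N" and U: "U \<lhd> G" "openin T U"
    and x: "x \<in> N (Suc j)" and g: "g \<in> carrier G"
  shows "\<exists>n\<in>N j. \<exists>w\<in>generate G {y [^] p | y. y \<in> N (Suc j)}. inv (commutator G x g) \<otimes> (n \<otimes> w) \<in> U"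
proof -
  define M where "M = N j"
  have M: "M \<lhd> G" and N: "N (Suc j) \<lhd> G" using eta by (auto simp: eta_series_def M_def)
  interpret M: normal M G by fact
  interpret U: normal U G by fact
  define q where "q = (\<lambda>x. M #> x)"
  interpret q: group_hom G "G Mod M" q unfolding q_def by (rule M.group_hom_Mod)
  define TQ where "TQ = quotient_group_topology G T M"
  define S where "S = {y [^] p | y. y \<in> N (Suc j)}"
  have NG: "N (Suc j) \<subseteq> carrier G" using normal_imp_subgroup[OF N] by (rule subgroup.subset)
  have SG: "S \<subseteq> carrier G" using NG by (auto simp: S_def)
  define c where "c = commutator G x g"
  have xG: "x \<in> carrier G" using NG x by blast
  have c: "c \<in> carrier G" using xG g by (simp add: c_def)
  have top: "topspace TQ = carrier (G Mod M)"
    unfolding TQ_def by (rule topspace_quotient_group_topology)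
  have pe: "commutator_subgroup (G Mod M) TQ (q ` N (Suc j)) (carrier (G Mod M)) \<subseteq>
      power_subgroup (G Mod M) TQ (q ` N (Suc j)) p"
    using eta by (simp add: eta_series_def powerfully_embedded_def M_def TQ_def q_def)
  let ?C = "{inv\<^bsub>G Mod M\<^esub> a \<otimes>\<^bsub>G Mod M\<^esub> inv\<^bsub>G Mod M\<^esub> b \<otimes>\<^bsub>G Mod M\<^esub> a \<otimes>\<^bsub>G Mod M\<^esub> b | a b.
      a \<in> q ` N (Suc j) \<and> b \<in> carrier (G Mod M)}"
  have "q c = commutator (G Mod M) (q x) (q g)"
    unfolding c_def using xG g by (rule q.hom_commutator)
  then have "q c \<in> ?C"
    unfolding commutator_def using x q.hom_closed[OF g] by blast
  then have "q c \<in> generate (G Mod M) ?C" by (rule generate.incl)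
  moreover have "q c \<in> topspace TQ" using c top by simp
  ultimately have "q c \<in> commutator_subgroup (G Mod M) TQ (q ` N (Suc j)) (carrier (G Mod M))"
    unfolding commutator_subgroup_def top_generate_def in_closure_of by blast
  then have "q c \<in> power_subgroup (G Mod M) TQ (q ` N (Suc j)) p" using pe by blast
  moreover have "{X [^]\<^bsub>G Mod M\<^esub> p | X. X \<in> q ` N (Suc j)} = q ` S"
  proof -
    have "q y [^]\<^bsub>G Mod M\<^esub> p = q (y [^] p)" if "y \<in> N (Suc j)" for y
      using q.hom_nat_pow[of y p] that NG by auto
    then show ?thesis by (force simp: S_def)
  qed
  ultimately have cl: "q c \<in> TQ closure_of (q ` generate G S)"
    using q.generate_img[OF SG] by (simp add: power_subgroup_def top_generate_def)
  define D where "D = {x \<in> carrier G. inv c \<otimes> x \<in> U}"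
  \<comment> \<open>\<open>D\<close> is the coset c U. Its image is open because the preimage of
    that image contains, with each point y, the whole coset y U: if q y = q d, then q (y u) = q (d
    u).\<close>
  have "openin T {x \<in> topspace T. q x \<in> q ` D}"
  proof (subst openin_subopen, intro ballI)
    fix y assume "y \<in> {x \<in> topspace T. q x \<in> q ` D}"
    then obtain d where y: "y \<in> carrier G" and d: "d \<in> D" "q y = q d" by (auto simp: topspace_eq)
    have dG: "d \<in> carrier G" and dU: "inv c \<otimes> d \<in> U" using d by (auto simp: D_def)
    have "q v \<in> q ` D" if v: "v \<in> carrier G" "inv y \<otimes> v \<in> U" for v
    proof -
      define u where "u = inv y \<otimes> v"
      have u: "u \<in> U" "u \<in> carrier G" using v y by (auto simp: u_def)
      have "q v = q (y \<otimes> u)" using v y by (simp add: u_def inv_mult_cancel_left)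
      also have "\<dots> = q (d \<otimes> u)" using d(2) y dG u by (simp del: mult_FactGroup)
      finally have qv: "q v = q (d \<otimes> u)" .
      have "inv c \<otimes> (d \<otimes> u) = (inv c \<otimes> d) \<otimes> u" using c dG u by (simp add: m_assoc)
      then have "d \<otimes> u \<in> D" using dU u dG by (simp add: D_def)
      then show ?thesis using qv by blast
    qed
    moreover have "y \<in> {v \<in> carrier G. inv y \<otimes> v \<in> U}" using y by simp
    ultimately show "\<exists>A. openin T A \<and> y \<in> A \<and> A \<subseteq> {x \<in> topspace T. q x \<in> q ` D}"
      using openin_left_translate[OF U(2) y] by (intro exI[of _ "{v \<in> carrier G. inv y \<otimes> v \<in> U}"]) (auto simp: topspace_eq)
  qed
  moreover have "q ` D \<subseteq> carrier (G Mod M)" by (auto simp: D_def)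
  ultimately have "openin TQ (q ` D)"
    unfolding TQ_def openin_quotient_group_topology q_def by blast
  moreover have "q c \<in> q ` D" using c by (simp add: D_def)
  ultimately have "\<exists>t. t \<in> q ` generate G S \<and> t \<in> q ` D"
    using cl[unfolded in_closure_of] by simp
  then obtain s where s: "s \<in> generate G S" "q s \<in> q ` D" by auto
  then obtain d where d: "d \<in> D" "q s = q d" by blast
  have sG: "s \<in> carrier G" using generate_in_carrier[OF SG s(1)] .
  have dG: "d \<in> carrier G" and dU: "inv c \<otimes> d \<in> U" using d by (auto simp: D_def)
  have "d \<in> M #> s" using d(2) rcos_self[OF dG M.subgroup_axioms] by (simp add: q_def)
  then obtain n where n: "n \<in> M" "d = n \<otimes> s" by (auto simp: r_coset_def)
  then show ?thesis using s(1) dU by (auto simp: M_def S_def c_def)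
qed

end

context pro_p_group
begin

text \<open>In the finite p-group \<open>G Mod U\<close> the images of the \<open>N j\<close>
  satisfy the hypotheses of \<open>finite_Omega_power_eq_one\<close>; the error in \<open>U\<close>
  left by the approximation of commutators disappears there.\<close>

lemma generate_power_mem_open_normal:
  assumes odd: "odd p" and eta: "eta_series p G T N" "N k = carrier G"
    and kl: "k \<le> l * (p - 1)" and U: "U \<lhd> G" "openin T U"
    and z: "z \<in> generate G {x \<in> carrier G. x [^] (p ^ i) = \<one>}"
  shows "z [^] (p ^ (i + l)) \<in> U"
proof -
  interpret U: normal U G by (rule U(1))
  obtain e where "order (G Mod U) = p ^ e" using open_normal_index[OF U] by blast
  then interpret F: finite_odd_p_group "G Mod U" p
    using U.factorgroup_is_group prime odd
    by (auto simp: finite_odd_p_group_def finite_odd_p_group_axioms_def finite_p_group_def finite_p_group_axioms_def)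
  define h where "h = (\<lambda>x. U #> x)"
  interpret h: group_hom G "G Mod U" h unfolding h_def by (rule U.group_hom_Mod)
  have one: "h x = \<one>\<^bsub>G Mod U\<^esub> \<longleftrightarrow> x \<in> U" if "x \<in> carrier G" for x
    unfolding h_def using that by (rule U.r_coset_one_iff)
  have onto: "h ` carrier G = carrier (G Mod U)" by (simp add: h_def carrier_FactGroup)
  have Nn: "N j \<lhd> G" for j using eta(1) by (simp add: eta_series_def)
  have NG: "N j \<subseteq> carrier G" for j using normal_imp_subgroup[OF Nn] by (rule subgroup.subset)
  define X where "X = {x \<in> carrier G. x [^] (p ^ i) = \<one>}"
  have XG: "X \<subseteq> carrier G" by (auto simp: X_def)
  have zG: "z \<in> carrier G" using z generate_in_carrier[OF XG] by (simp add: X_def)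
  have "h z [^]\<^bsub>G Mod U\<^esub> (p ^ (i + l)) = \<one>\<^bsub>G Mod U\<^esub>"
  proof (rule F.finite_Omega_power_eq_one[where N = "\<lambda>j. h ` N j" and k = k])
    show "h ` N 0 = {\<one>\<^bsub>G Mod U\<^esub>}" using eta(1) by (simp add: eta_series_def del: one_FactGroup)
    show "h ` N k = carrier (G Mod U)" using eta(2) onto by simp
    show "h ` N j \<lhd> G Mod U" for j
      using normal.surj_hom_normal_subgroup[OF Nn h.group_hom_axioms onto] .
    show "k \<le> l * (p - 1)" by (rule kl)
    show "h z \<in> generate (G Mod U) {x \<in> carrier (G Mod U). x [^]\<^bsub>G Mod U\<^esub> (p ^ i) = \<one>\<^bsub>G Mod U\<^esub>}"
    proof -
      have "h ` X \<subseteq> {x \<in> carrier (G Mod U). x [^]\<^bsub>G Mod U\<^esub> (p ^ i) = \<one>\<^bsub>G Mod U\<^esub>}"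
        using h.hom_nat_pow[symmetric] by (auto simp: X_def simp del: one_FactGroup)
      moreover have "h z \<in> generate (G Mod U) (h ` X)"
        using h.generate_img[OF XG] z by (simp add: X_def)
      ultimately show ?thesis
        by (rule subsetD[OF F.mono_generate])
    qed
    fix j X Y assume "X \<in> h ` N (Suc j)" "Y \<in> carrier (G Mod U)"
    then obtain x g where x: "x \<in> N (Suc j)" "X = h x" and g: "g \<in> carrier G" "Y = h g"
      using onto by (metis imageE)
    define S where "S = {y [^] p | y. y \<in> N (Suc j)}"
    have SG: "S \<subseteq> carrier G" using NG by (auto simp: S_def)
    have xG: "x \<in> carrier G" using x NG by blast
    define c where "c = commutator G x g"
    have c: "c \<in> carrier G" using xG g by (simp add: c_def)
    obtain n w where n: "n \<in> N j" and w: "w \<in> generate G S" and nw: "inv c \<otimes> (n \<otimes> w) \<in> U"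
      using eta_series_commutator_mem[OF eta(1) U x(1) g(1)] unfolding S_def c_def by blast
    have nG: "n \<in> carrier G" and wG: "w \<in> carrier G" using n NG generate_in_carrier[OF SG w] by blast+
    have "inv\<^bsub>G Mod U\<^esub> h c \<otimes>\<^bsub>G Mod U\<^esub> h (n \<otimes> w) = \<one>\<^bsub>G Mod U\<^esub>"
      using one[of "inv c \<otimes> (n \<otimes> w)"] nw c nG wG by (simp del: one_FactGroup mult_FactGroup)
    then have "h c = h (n \<otimes> w)"
      using F.inv_mult_cancel_left(2)[of "h c" "h (n \<otimes> w)"] c nG wG
      by (simp del: one_FactGroup mult_FactGroup)
    moreover have "commutator (G Mod U) X Y = h c"
      unfolding c_def x(2) g(2) using h.hom_commutator[OF xG g(1)] by simp
    ultimately have "commutator (G Mod U) X Y = h n \<otimes>\<^bsub>G Mod U\<^esub> h w"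
      using nG wG by (simp del: mult_FactGroup)
    moreover have "h w \<in> power_gen (G Mod U) p (h ` N (Suc j))"
    proof -
      have "h (y [^] p) = h y [^]\<^bsub>G Mod U\<^esub> p" if "y \<in> N (Suc j)" for y
        using h.hom_nat_pow that NG by blast
      then have "h ` S = {X [^]\<^bsub>G Mod U\<^esub> p | X. X \<in> h ` N (Suc j)}" by (force simp: S_def)
      then show ?thesis using h.generate_img[OF SG] w unfolding power_gen_def by auto
    qed
    ultimately show "commutator (G Mod U) X Y \<in> h ` N j <#>\<^bsub>G Mod U\<^esub> power_gen (G Mod U) p (h ` N (Suc j))"
      using n unfolding set_mult_def[of "G Mod U"] by blast
  qed
  then show ?thesis
    using one[of "z [^] (p ^ (i + l))"] h.hom_nat_pow[OF zG] zG by (simp del: one_FactGroup)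
qed

text \<open>Elements of the closure agree modulo any open normal \<open>U\<close> with elements of
  the abstractly generated subgroup, and such \<open>U\<close> separate a nontrivial power from
  1.\<close>

lemma Omega_power_eq_one:
  assumes "odd p" "eta_series p G T N" "N k = carrier G" "k \<le> l * (p - 1)"
    and z: "z \<in> Omega_subgroup p G T i"
  shows "z [^] (p ^ (i + l)) = \<one>"
proof (rule ccontr)
  assume ne: "z [^] (p ^ (i + l)) \<noteq> \<one>"
  have zG: "z \<in> carrier G" using z by (simp add: Omega_subgroup_def top_generate_def in_closure_of topspace_eq)
  then obtain U where U: "U \<lhd> G" "openin T U" and nU: "z [^] (p ^ (i + l)) \<notin> U"
    using open_normal_subgroup_separation[OF _ ne] by auto
  interpret U: normal U G by (rule U(1))
  obtain s where s: "s \<in> generate G {x \<in> carrier G. x [^] (p ^ i) = \<one>}" "s \<in> carrier G" "inv z \<otimes> s \<in> U"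
    using closure_of_coset_meets[OF z[unfolded Omega_subgroup_def top_generate_def] U(2)] U.one_closed by blast
  define h where "h = (\<lambda>x. U #> x)"
  interpret h: group_hom G "G Mod U" h unfolding h_def by (rule U.group_hom_Mod)
  have one: "h x = \<one>\<^bsub>G Mod U\<^esub> \<longleftrightarrow> x \<in> U" if "x \<in> carrier G" for x
    unfolding h_def using that by (rule U.r_coset_one_iff)
  have "s = z \<otimes> (inv z \<otimes> s)" using zG s(2) by (simp add: inv_mult_cancel_left)
  then have "h s = h z \<otimes>\<^bsub>G Mod U\<^esub> h (inv z \<otimes> s)" using zG s(2) by (metis h.hom_mult m_closed inv_closed)
  also have "\<dots> = h z" using one[of "inv z \<otimes> s"] s zG by (simp del: one_FactGroup mult_FactGroup)
  finally have "h (z [^] (p ^ (i + l))) = h (s [^] (p ^ (i + l)))"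
    using zG s(2) by (simp add: h.hom_nat_pow)
  moreover have "s [^] (p ^ (i + l)) \<in> U"
    using assms(1-4) U s(1) by (rule generate_power_mem_open_normal)
  ultimately show False
    using nU one[of "z [^] (p ^ (i + l))"] one[of "s [^] (p ^ (i + l))"] zG s(2) by simp
qed

end

theorem theorem4p1:
  fixes G :: "('a, 'b) monoid_scheme" and T :: "'a topology"
    and p k :: nat and l :: int
  assumes "prime p" and "odd p"
    and "pro_p_group G T p"
    and "top_finitely_generated G T"
    and "has_powerful_class p G T k"
    and "int k \<le> l * (int p - 1)"
  shows "\<forall>i::nat. power_subgroup G T (Omega_subgroup p G T i) (p ^ (i + nat l)) = {\<one>\<^bsub>G\<^esub>}"
proof
  fix i
  interpret pro_p_group G T p by fact
  obtain N where N: "eta_series p G T N" "N k = carrier G"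
    using assms(5) by (auto simp: has_powerful_class_def)
  have p: "1 < p" using assms(1) by (rule prime_gt_1_nat)
  have "0 \<le> l"
  proof (rule ccontr)
    \<comment> \<open>A negative \<open>l\<close> would make the bound on \<open>k\<close> negative;
      hence \<open>nat l\<close> loses nothing.\<close>
    assume "\<not> 0 \<le> l"
    then have "l * (int p - 1) < 0" using p by (intro mult_neg_pos) auto
    then show False using assms(6) by simp
  qed
  then have "int k \<le> int (nat l * (p - 1))" using assms(6) p by (simp add: of_nat_diff)
  then have kl: "k \<le> nat l * (p - 1)" by (simp only: of_nat_le_iff)
  let ?S = "{x [^]\<^bsub>G\<^esub> (p ^ (i + nat l)) | x. x \<in> Omega_subgroup p G T i}"
  have "\<one>\<^bsub>G\<^esub> \<in> Omega_subgroup p G T i"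
    unfolding Omega_subgroup_def top_generate_def in_closure_of topspace_eq
    using generate.one one_closed by blast
  then have "?S = {\<one>\<^bsub>G\<^esub>}"
    using Omega_power_eq_one[OF assms(2) N kl] by force
  then have "generate G ?S = {\<one>\<^bsub>G\<^esub>}" using generate_one by simp
  moreover have "T closure_of {\<one>\<^bsub>G\<^esub>} = {\<one>\<^bsub>G\<^esub>}"
    using closedin_Hausdorff_singleton[OF Hausdorff] one_closed by (simp add: closure_of_closedin topspace_eq)
  ultimately show "power_subgroup G T (Omega_subgroup p G T i) (p ^ (i + nat l)) = {\<one>\<^bsub>G\<^esub>}"
    by (simp add: power_subgroup_def top_generate_def)
qed

end
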